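(* Let $\kappa,\tau,H\in\mathbb{R}$, let $\Sigma$ be a simply connected Riemann surface, and let $X:\Sigma\to\mathbb{E}(\kappa,\tau)$ (a nowhere vertical conformal immersion with constant mean curvature $H$) and $\widetilde X:\Sigma\to\mathbb{L}(\kappa,H)$ (a spacelike conformal immersion with constant mean curvature $\tau$) be dual conformal immersions. Let $a,b,\widetilde a,\widetilde b\in\mathbb{C}$ satisfy $$(\kappa-4\tau^2)a+2(H+i\tau)b=0,\qquad (\kappa+4H^2)\widetilde a+2i(H+i\tau)\widetilde b=0.$$ Then $$X^*Q_{a,b}=\widetilde X^*\widetilde Q_{\widetilde a,\widetilde b}$$ whenever $\widetilde a=-ia$ and $(\kappa-4\tau^2)\widetilde b+(\kappa+4H^2)b=0$.
   Context: Spaces. $\mathbb{M}^2(\kappa)$ is the complete simply connected surface of constant curvature $\kappa$. $\mathbb{E}(\kappa,\tau)$ (resp. $\mathbb{L}(\kappa,H)$) is the simply connected Riemannian (resp. Lorentzian) 3-manifold with a Killing submersion $\pi$ (resp. $\widetilde\pi$) over $\mathbb{M}^2(\kappa)$ with constant bundle curvature $\tau$ (resp. $H$), whose fibers are the integral curves of a unit (resp. unit timelike) Killing field. Put $\lambda=(1+\frac{\kappa}{4}(x^2+y^2))^{-1}$ on $\Omega_\kappa=\{(x,y)\in\mathbb{R}^2:1+\frac{\kappa}{4}(x^2+y^2)>0\}$. Locally (globally if $\kappa\le 0$) these spaces are modeled by $\Omega_\kappa\times\mathbb{R}$ with metrics $$ds^2_{\mathbb{E}(\kappa,\tau)}=\lambda^2(dx^2+dy^2)+(dz+\tau\lambda(y\,dx-x\,dy))^2,$$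 $$ds^2_{\mathbb{L}(\kappa,H)}=\lambda^2(dx^2+dy^2)-(dz-H\lambda(y\,dx-x\,dy))^2,$$ the submersions being $(x,y,z)\mapsto(x,y)$, with Killing fields $E_3=\partial_z$ and $\widetilde E_3=\partial_z$ respectively. The ambient orientation is the usual one of $\mathbb{R}^3$. Conventions for surfaces. An immersed surface in $\mathbb{E}(\kappa,\tau)$ is nowhere vertical if $E_3$ is nowhere tangent to it; spacelike surfaces in $\mathbb{L}(\kappa,H)$ are automatically nowhere vertical. $N$, $\widetilde N$ denote the upward-pointing unit normals (positive $\partial_z$-component); $J$ is the $\frac{\pi}{2}$-rotation $JX=N\times X$ (resp. $JX=\widetilde N\times X$), where $\langle N\times X,Y\rangle=\det(N,X,Y)$; equivalently, rotation by $+\frac{\pi}{2}$ for the orientation of the surface that projects to the standard orientation of the $(x,y)$-base. Second fundamental forms: $\sigma(X,Y)=\langle\overline\nabla_XY,N\rangle$ and $\widetilde\sigma(X,Y)=\langle\widetilde\nabla_XY,\widetilde N\rangle$ with $\overline\nabla,\widetilde\nabla$ the Levi-Civita connections. Mean curvature $H$ in $\mathbb{E}(\kappa,\tau)$ means $\mathrm{trace}(\sigma)=2H$; mean curvature $\tau$ in $\mathbb{L}(\kappa,H)$ means $\mathrm{trace}(\widetilde\sigma)=-2\tau$ (traces with respect to the induced metric). Duality. For the graph $z=u(x,y)$ in $\mathbb{E}(\kappa,\tau)$ and the spacelike graph $z=v(x,y)$ in $\mathbb{L}(\kappa,H)$ over a common domain, put $\alpha=\frac{u_x}{\lambda}+\tau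 y$, $\beta=\frac{u_y}{\lambda}-\tau x$, $\omega=(1+\alpha^2+\beta^2)^{1/2}$, $\widetilde\alpha=\frac{v_x}{\lambda}-Hy$, $\widetilde\beta=\frac{v_y}{\lambda}+Hx$, $\widetilde\omega=(1-\widetilde\alpha^2-\widetilde\beta^2)^{1/2}$. The graphs are dual if they satisfy the twin relations $$(\alpha,\beta)=\Big(\frac{\widetilde\beta}{\widetilde\omega},\frac{-\widetilde\alpha}{\widetilde\omega}\Big)\iff(\widetilde\alpha,\widetilde\beta)=\Big(\frac{-\beta}{\omega},\frac{\alpha}{\omega}\Big).$$ A nowhere vertical conformal immersion $X:\Sigma\to\mathbb{E}(\kappa,\tau)$ with constant mean curvature $H$ and a spacelike conformal immersion $\widetilde X:\Sigma\to\mathbb{L}(\kappa,H)$ with constant mean curvature $\tau$ are dual if $\pi\circ X=\widetilde\pi\circ\widetilde X$ and, locally, where they are graphs $z=u(x,y)$ and $z=v(x,y)$ over a common domain of the base, the functions $u$ and $v$ satisfy the twin relations. Quadratic differentials. Extending $\sigma,\widetilde\sigma,\langle\cdot,\cdot\rangle$ complex-bilinearly, for tangent vectors $X,Y$, $$Q_{a,b}(X,Y)=a\,\sigma(X-iJX,Y-iJY)+b\,\langle X-iJX,E_3\rangle\langle Y-iJY,E_3\rangle,$$ $$\widetilde Q_{\widetilde a,\widetilde b}(X,Y)=\widetilde a\,\widetilde\sigma(X-iJX,Y-iJY)+\widetilde b\,\langle X-iJX,\widetilde E_3\rangle\langle Y-iJY,\widetilde E_3\rangle.$$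
   Formalization: In the case κ=τ=H=0, where the three linear conditions on the coefficients are void and the claim fails (e.g. a=0, b=1, b̃=0 for a tilted plane and its dual), it is additionally assumed that b̃=−b; all other (κ,τ,H) are as stated. *)

theory Defs
  imports "HOL-Analysis.Analysis"
begin

section \<open>Smooth maps\<close>

(* For open S in a finite-dimensional space: f is of class C^k on S. *)
primrec Ck_on :: "nat \<Rightarrow> 'a::real_normed_vector set \<Rightarrow> ('a \<Rightarrow> 'b::real_normed_vector) \<Rightarrow> bool" where
  "Ck_on 0 S f \<longleftrightarrow> continuous_on S f"
| "Ck_on (Suc k) S f \<longleftrightarrow> (\<forall>x\<in>S. f differentiable (at x)) \<and>
     (\<forall>v. Ck_on k S (\<lambda>x. frechet_derivative f (at x) v))"

definition smooth_on :: "'a::real_normed_vector set \<Rightarrow> ('a \<Rightarrow> 'b::real_normed_vector) \<Rightarrow> bool" where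
  "smooth_on S f \<longleftrightarrow> (\<forall>k. Ck_on k S f)"

abbreviation D :: "('a::real_normed_vector \<Rightarrow> 'b::real_normed_vector) \<Rightarrow> 'a \<Rightarrow> 'a \<Rightarrow> 'b" where
  "D f x \<equiv> frechet_derivative f (at x)"


section \<open>The model metrics\<close>

definition conf_factor :: "real \<Rightarrow> real \<Rightarrow> real \<Rightarrow> real" where
  "conf_factor \<kappa> x y = 1 / (1 + \<kappa> / 4 * (x\<^sup>2 + y\<^sup>2))"

definition Omega :: "real \<Rightarrow> (real \<times> real) set" where
  "Omega \<kappa> = {(x, y). 1 + \<kappa> / 4 * (x\<^sup>2 + y\<^sup>2) > 0}"

(* g p u v is the inner product of the tangent vectors u, v at the point p of an open part of R^3. *)
type_synonym metric = "real^3 \<Rightarrow> real^3 \<Rightarrow> real^3 \<Rightarrow> real"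

definition E_metric :: "real \<Rightarrow> real \<Rightarrow> metric" where
  "E_metric \<kappa> \<tau> p u v =
    (let x = p$1; y = p$2; l = conf_factor \<kappa> x y;
         \<theta> = (\<lambda>w::real^3. w$3 + \<tau> * l * (y * w$1 - x * w$2))
     in l\<^sup>2 * (u$1 * v$1 + u$2 * v$2) + \<theta> u * \<theta> v)"

definition L_metric :: "real \<Rightarrow> real \<Rightarrow> metric" where
  "L_metric \<kappa> H p u v =
    (let x = p$1; y = p$2; l = conf_factor \<kappa> x y;
         \<theta> = (\<lambda>w::real^3. w$3 - H * l * (y * w$1 - x * w$2))
     in l\<^sup>2 * (u$1 * v$1 + u$2 * v$2) - \<theta> u * \<theta> v)"

definition e3 :: "real^3" where
  "e3 = axis 3 1"

definition base_coords :: "real^3 \<Rightarrow> real \<times> real" where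
  "base_coords p = (p$1, p$2)"


section \<open>Pseudo-Riemannian geometry in coordinates\<close>

definition metric_matrix :: "metric \<Rightarrow> real^3 \<Rightarrow> real^3^3" where
  "metric_matrix g p = (\<chi> i j. g p (axis i 1) (axis j 1))"

definition d_metric :: "metric \<Rightarrow> real^3 \<Rightarrow> 3 \<Rightarrow> 3 \<Rightarrow> 3 \<Rightarrow> real" where
  "d_metric g p i j k = D (\<lambda>q. metric_matrix g q $ j $ k) p (axis i 1)"

(* The symbols Gamma^k_ij of the Levi-Civita connection. *)
definition christoffel :: "metric \<Rightarrow> real^3 \<Rightarrow> 3 \<Rightarrow> 3 \<Rightarrow> 3 \<Rightarrow> real" where
  "christoffel g p k i j =
    (\<Sum>l\<in>UNIV. matrix_inv (metric_matrix g p) $ k $ l *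
       (d_metric g p i j l + d_metric g p j i l - d_metric g p l i j)) / 2"

(* Defined by <n x v, w> = det(n, v, w), where det is the volume form of g for the
   standard orientation of R^3. *)
definition cross_product :: "metric \<Rightarrow> real^3 \<Rightarrow> real^3 \<Rightarrow> real^3 \<Rightarrow> real^3" where
  "cross_product g p n v =
    (THE x. \<forall>w. g p x w = sqrt \<bar>det (metric_matrix g p)\<bar> * det (vector [n, v, w] :: real^3^3))"


section \<open>Surfaces in coordinates\<close>

(* In this section f is an immersion of an open part of the complex plane into an open part of R^3
   with metric g, and z is a point of its domain. *)

(* The covariant derivative, in direction D f z v, of the vector field D f w along f. *)
definition cov_deriv :: "metric \<Rightarrow> (complex \<Rightarrow> real^3) \<Rightarrow> complex \<Rightarrow> complex \<Rightarrow> complex \<Rightarrow> real^3" where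
  "cov_deriv g f z v w = D (\<lambda>z'. D f z' w) z v +
    (\<chi> k. \<Sum>i\<in>UNIV. \<Sum>j\<in>UNIV. christoffel g (f z) k i j * (D f z v $ i) * (D f z w $ j))"

(* The component of n along the Killing field e3 is taken with respect to the orthogonal splitting
   into the line of e3 and its complement: it is <n, e3> / <e3, e3>. Upward-pointing thus means
   <n, e3> > 0 in the Riemannian and <n, e3> < 0 in the Lorentzian case. The third coordinate n$3 is
   not this component, as the horizontal lifts of d/dx and d/dy have third coordinates, too. *)
definition unit_normal :: "metric \<Rightarrow> (complex \<Rightarrow> real^3) \<Rightarrow> complex \<Rightarrow> real^3" where
  "unit_normal g f z =
    (THE n. (\<forall>v. g (f z) n (D f z v) = 0) \<and> \<bar>g (f z) n n\<bar> = 1 \<and>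
            g (f z) n e3 / g (f z) e3 e3 > 0)"

(* The second fundamental form on vectors x, y tangent to the surface, i.e. in the range of D f z. *)
definition second_ff ::
  "metric \<Rightarrow> (complex \<Rightarrow> real^3) \<Rightarrow> complex \<Rightarrow> real^3 \<Rightarrow> real^3 \<Rightarrow> real" where
  "second_ff g f z x y =
    g (f z) (cov_deriv g f z (inv (D f z) x) (inv (D f z) y)) (unit_normal g f z)"

definition rot_J :: "metric \<Rightarrow> (complex \<Rightarrow> real^3) \<Rightarrow> complex \<Rightarrow> real^3 \<Rightarrow> real^3" where
  "rot_J g f z x = cross_product g (f z) (unit_normal g f z) x"

(* The trace of the second fundamental form with respect to the induced metric, computed in the
   basis of coordinate fields. *)
definition trace_second_ff :: "metric \<Rightarrow> (complex \<Rightarrow> real^3) \<Rightarrow> complex \<Rightarrow> real" where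
  "trace_second_ff g f z =
    (let x = D f z 1; y = D f z \<i>; I = g (f z); S = second_ff g f z
     in (S x x * I y y - 2 * S x y * I x y + S y y * I x x) / (I x x * I y y - (I x y)\<^sup>2))"


section \<open>The quadratic differentials\<close>

(* Complex-linear and complex-bilinear extensions; a pair (x, y) stands for the complexified
   vector x + i y. *)
definition cx_linear :: "('v \<Rightarrow> real) \<Rightarrow> 'v \<times> 'v \<Rightarrow> complex" where
  "cx_linear l = (\<lambda>(x, y). Complex (l x) (l y))"

definition cx_bilinear :: "('v \<Rightarrow> 'v \<Rightarrow> real) \<Rightarrow> 'v \<times> 'v \<Rightarrow> 'v \<times> 'v \<Rightarrow> complex" where
  "cx_bilinear B = (\<lambda>(x, y) (x', y'). Complex (B x x' - B y y') (B x y' + B y x'))"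

definition quad_diff ::
  "metric \<Rightarrow> complex \<Rightarrow> complex \<Rightarrow> (complex \<Rightarrow> real^3) \<Rightarrow> complex \<Rightarrow> real^3 \<Rightarrow> real^3 \<Rightarrow> complex" where
  "quad_diff g a b f z x y =
    (let x' = (x, - rot_J g f z x); y' = (y, - rot_J g f z y); h = (\<lambda>w. g (f z) w e3)
     in a * cx_bilinear (second_ff g f z) x' y' + b * cx_linear h x' * cx_linear h y')"

definition pullback_quad_diff ::
  "metric \<Rightarrow> complex \<Rightarrow> complex \<Rightarrow> (complex \<Rightarrow> real^3) \<Rightarrow> complex \<Rightarrow> complex \<Rightarrow> complex \<Rightarrow> complex" where
  "pullback_quad_diff g a b f z v w = quad_diff g a b f z (D f z v) (D f z w)"


section \<open>The surfaces of constant curvature\<close>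

(* The complete simply connected surface of curvature k: for k > 0 the round sphere of radius
   1 / sqrt k; for k <= 0 the domain Omega k with the metric of conformal factor conf_factor k. *)
definition M2 :: "real \<Rightarrow> (real^3) set" where
  "M2 \<kappa> = (if \<kappa> > 0 then sphere 0 (1 / sqrt \<kappa>)
           else {p. (p$1, p$2) \<in> Omega \<kappa> \<and> p$3 = 0})"

(* An atlas of oriented charts of M2 k with values in Omega k in which the metric is
   conf_factor^2 (dx^2 + dy^2). For k > 0 these are two stereographic projections which differ by the
   rotation by pi about the first axis of R^3; in the complex coordinate the transition map is
   z |-> 4 / (k z). *)
definition M2_charts :: "real \<Rightarrow> ((real^3) set \<times> (real^3 \<Rightarrow> real \<times> real)) set" where
  "M2_charts \<kappa> =
    (if \<kappa> > 0 then
       {(M2 \<kappa> - {vector [0, 0, - 1 / sqrt \<kappa>]},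
         \<lambda>p. (2 * p$1 / (1 + sqrt \<kappa> * p$3), 2 * p$2 / (1 + sqrt \<kappa> * p$3))),
        (M2 \<kappa> - {vector [0, 0, 1 / sqrt \<kappa>]},
         \<lambda>p. (2 * p$1 / (1 - sqrt \<kappa> * p$3), - 2 * p$2 / (1 - sqrt \<kappa> * p$3)))}
     else {(M2 \<kappa>, base_coords)})"


section \<open>The spaces E(k, t) and L(k, H)\<close>

(* A model chart (U, P, V, c): P is a chart with domain U and values in Omega k x R, in which the
   submersion becomes (x, y, z) |-> (x, y) when (V, c) is used as a chart of the base M2 k. *)
type_synonym 'e model_chart =
  "'e set \<times> ('e \<Rightarrow> real^3) \<times> (real^3) set \<times> (real^3 \<Rightarrow> real \<times> real)"

record 'e killing_space =
  base_proj :: "'e \<Rightarrow> real^3"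
  model_charts :: "'e model_chart set"

definition is_model_chart ::
  "real \<Rightarrow> ('e::topological_space \<Rightarrow> real^3) \<Rightarrow> 'e model_chart \<Rightarrow> bool" where
  "is_model_chart \<kappa> \<pi> = (\<lambda>(U, \<Phi>, V, \<phi>).
     open U \<and> open (\<Phi> ` U) \<and> homeomorphism U (\<Phi> ` U) \<Phi> (inv_into U \<Phi>) \<and>
     base_coords ` \<Phi> ` U \<subseteq> Omega \<kappa> \<and>
     (V, \<phi>) \<in> M2_charts \<kappa> \<and> (\<forall>p\<in>U. \<pi> p \<in> V \<and> base_coords (\<Phi> p) = \<phi> (\<pi> p)))"

(* The transition maps are isometries of g which preserve e3. Together with the compatibility with
   the oriented charts of the base they preserve the standard orientation of R^3. *)
definition compatible_charts :: "metric \<Rightarrow> 'e model_chart \<Rightarrow> 'e model_chart \<Rightarrow> bool" where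
  "compatible_charts g = (\<lambda>(U, \<Phi>, V, \<phi>) (U', \<Phi>', V', \<phi>').
     let T = \<Phi>' \<circ> inv_into U \<Phi>; S = \<Phi> ` (U \<inter> U')
     in smooth_on S T \<and>
        (\<forall>p\<in>S. D T p e3 = e3 \<and> (\<forall>u v. g (T p) (D T p u) (D T p v) = g p u v)))"

(* A simply connected space with a submersion onto M2 k which is locally modelled on Omega k x R with
   the metric g and the Killing field e3, such that every fiber is an integral curve, defined on the
   whole real line, of the Killing field. The model charts carry the metric, the orientation, the
   Killing field and, through g, the bundle curvature. Around every point there is a model chart over
   each of the charts of M2 k that are defined at its projection. *)
definition killing_space_over :: "metric \<Rightarrow> real \<Rightarrow> 'e::topological_space killing_space \<Rightarrow> bool" where
  "killing_space_over g \<kappa> M \<longleftrightarrow>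
     simply_connected (UNIV :: 'e set) \<and>
     range (base_proj M) = M2 \<kappa> \<and>
     (\<forall>C\<in>model_charts M. is_model_chart \<kappa> (base_proj M) C) \<and>
     (\<forall>C\<in>model_charts M. \<forall>C'\<in>model_charts M. compatible_charts g C C') \<and>
     (\<forall>p. \<forall>(V, \<phi>)\<in>M2_charts \<kappa>. base_proj M p \<in> V \<longrightarrow>
        (\<exists>U \<Phi>. (U, \<Phi>, V, \<phi>) \<in> model_charts M \<and> p \<in> U)) \<and>
     (\<forall>p. \<exists>c::real \<Rightarrow> 'e. continuous_on UNIV c \<and>
        range c = {q. base_proj M q = base_proj M p} \<and>
        (\<forall>t. \<forall>(U, \<Phi>, V, \<phi>)\<in>model_charts M. c t \<in> U \<longrightarrow>
           ((\<lambda>s. \<Phi> (c s)) has_vector_derivative e3) (at t)))"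

definition E_space :: "real \<Rightarrow> real \<Rightarrow> 'e::{t2_space, second_countable_topology} killing_space \<Rightarrow> bool" where
  "E_space \<kappa> \<tau> M \<longleftrightarrow> killing_space_over (E_metric \<kappa> \<tau>) \<kappa> M"

definition L_space :: "real \<Rightarrow> real \<Rightarrow> 'e::{t2_space, second_countable_topology} killing_space \<Rightarrow> bool" where
  "L_space \<kappa> H M \<longleftrightarrow> killing_space_over (L_metric \<kappa> H) \<kappa> M"


section \<open>Immersions of Riemann surfaces\<close>

type_synonym 's complex_atlas = "('s set \<times> ('s \<Rightarrow> complex)) set"

definition riemann_surface :: "'s::t2_space complex_atlas \<Rightarrow> bool" where
  "riemann_surface A \<longleftrightarrow>
     connected (UNIV :: 's set) \<and> (\<Union>(W, \<zeta>)\<in>A. W) = UNIV \<and>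
     (\<forall>(W, \<zeta>)\<in>A. open W \<and> open (\<zeta> ` W) \<and> homeomorphism W (\<zeta> ` W) \<zeta> (inv_into W \<zeta>)) \<and>
     (\<forall>(W, \<zeta>)\<in>A. \<forall>(W', \<zeta>')\<in>A. (\<zeta>' \<circ> inv_into W \<zeta>) holomorphic_on \<zeta> ` (W \<inter> W'))"

definition local_rep :: "'s set \<times> ('s \<Rightarrow> complex) \<Rightarrow> 'e model_chart \<Rightarrow> ('s \<Rightarrow> 'e) \<Rightarrow> complex \<Rightarrow> real^3" where
  "local_rep = (\<lambda>(W, \<zeta>) (U, \<Phi>, V, \<phi>) X. \<Phi> \<circ> X \<circ> inv_into W \<zeta>)"

(* P holds for every local representation of X, at every point of its domain. *)
definition everywhere_locally ::
  "'s complex_atlas \<Rightarrow> 'e killing_space \<Rightarrow> ('s \<Rightarrow> 'e) \<Rightarrow> ((complex \<Rightarrow> real^3) \<Rightarrow> complex \<Rightarrow> bool) \<Rightarrow> bool" where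
  "everywhere_locally A M X P \<longleftrightarrow>
     (\<forall>(W, \<zeta>)\<in>A. \<forall>(U, \<Phi>, V, \<phi>)\<in>model_charts M. \<forall>p\<in>W. X p \<in> U \<longrightarrow>
        P (local_rep (W, \<zeta>) (U, \<Phi>, V, \<phi>) X) (\<zeta> p))"

(* The induced metric is rho |dz|^2 with rho > 0. *)
definition conformal_immersion ::
  "metric \<Rightarrow> 's::t2_space complex_atlas \<Rightarrow> 'e::topological_space killing_space \<Rightarrow> ('s \<Rightarrow> 'e) \<Rightarrow> bool" where
  "conformal_immersion g A M X \<longleftrightarrow>
     continuous_on UNIV X \<and>
     (\<forall>(W, \<zeta>)\<in>A. \<forall>(U, \<Phi>, V, \<phi>)\<in>model_charts M.
        smooth_on (\<zeta> ` (W \<inter> X -` U)) (local_rep (W, \<zeta>) (U, \<Phi>, V, \<phi>) X)) \<and>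
     everywhere_locally A M X (\<lambda>f z. inj (D f z) \<and>
        (\<exists>\<rho>>0. \<forall>v w. g (f z) (D f z v) (D f z w) = \<rho> * (v \<bullet> w)))"

definition nowhere_vertical ::
  "'s complex_atlas \<Rightarrow> 'e killing_space \<Rightarrow> ('s \<Rightarrow> 'e) \<Rightarrow> bool" where
  "nowhere_vertical A M X \<longleftrightarrow> everywhere_locally A M X (\<lambda>f z. e3 \<notin> range (D f z))"

definition spacelike :: "metric \<Rightarrow> 's complex_atlas \<Rightarrow> 'e killing_space \<Rightarrow> ('s \<Rightarrow> 'e) \<Rightarrow> bool" where
  "spacelike g A M X \<longleftrightarrow>
     everywhere_locally A M X (\<lambda>f z. \<forall>v. v \<noteq> 0 \<longrightarrow> g (f z) (D f z v) (D f z v) > 0)"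

(* Mean curvature H means trace = 2 H in the Riemannian and trace = - 2 H in the Lorentzian case. *)
definition mean_curvature_E ::
  "real \<Rightarrow> real \<Rightarrow> 's complex_atlas \<Rightarrow> 'e killing_space \<Rightarrow> ('s \<Rightarrow> 'e) \<Rightarrow> real \<Rightarrow> bool" where
  "mean_curvature_E \<kappa> \<tau> A M X m \<longleftrightarrow>
     everywhere_locally A M X (\<lambda>f z. trace_second_ff (E_metric \<kappa> \<tau>) f z = 2 * m)"

definition mean_curvature_L ::
  "real \<Rightarrow> real \<Rightarrow> 's complex_atlas \<Rightarrow> 'e killing_space \<Rightarrow> ('s \<Rightarrow> 'e) \<Rightarrow> real \<Rightarrow> bool" where
  "mean_curvature_L \<kappa> H A M X m \<longleftrightarrow>
     everywhere_locally A M X (\<lambda>f z. trace_second_ff (L_metric \<kappa> H) f z = - 2 * m)"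


section \<open>Duality\<close>

definition twin_relations ::
  "real \<Rightarrow> real \<Rightarrow> real \<Rightarrow> (real \<times> real) set \<Rightarrow> (real \<times> real \<Rightarrow> real) \<Rightarrow> (real \<times> real \<Rightarrow> real) \<Rightarrow> bool" where
  "twin_relations \<kappa> \<tau> H R u v \<longleftrightarrow>
     (\<forall>(x, y)\<in>R.
        let l = conf_factor \<kappa> x y;
            \<alpha> = D u (x, y) (1, 0) / l + \<tau> * y;
            \<beta> = D u (x, y) (0, 1) / l - \<tau> * x;
            \<alpha>' = D v (x, y) (1, 0) / l - H * y;
            \<beta>' = D v (x, y) (0, 1) / l + H * x;
            \<omega>' = sqrt (1 - \<alpha>'\<^sup>2 - \<beta>'\<^sup>2)
        in (\<alpha>, \<beta>) = (\<beta>' / \<omega>', - \<alpha>' / \<omega>'))"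

definition graph_over :: "(real \<times> real) set \<Rightarrow> (real \<times> real \<Rightarrow> real) \<Rightarrow> (real^3) set" where
  "graph_over R u = {q. base_coords q \<in> R \<and> q$3 = u (base_coords q)}"

(* Every point has a neighbourhood on which both immersions are graphs, in model charts over the same
   chart of the base, and the twin relations hold. They do not depend on the choice of such charts. *)
definition dual_immersions ::
  "real \<Rightarrow> real \<Rightarrow> real \<Rightarrow> 'e killing_space \<Rightarrow> 'l killing_space \<Rightarrow>
   ('s::topological_space \<Rightarrow> 'e) \<Rightarrow> ('s \<Rightarrow> 'l) \<Rightarrow> bool" where
  "dual_immersions \<kappa> \<tau> H M M' X X' \<longleftrightarrow>
     base_proj M \<circ> X = base_proj M' \<circ> X' \<and>
     (\<forall>p. \<exists>N U \<Phi> U' \<Phi>' V \<phi> R u v.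
        open N \<and> p \<in> N \<and>
        (U, \<Phi>, V, \<phi>) \<in> model_charts M \<and> X ` N \<subseteq> U \<and>
        (U', \<Phi>', V, \<phi>) \<in> model_charts M' \<and> X' ` N \<subseteq> U' \<and>
        open R \<and> smooth_on R u \<and> smooth_on R v \<and>
        \<Phi> ` X ` N = graph_over R u \<and> \<Phi>' ` X' ` N = graph_over R v \<and>
        twin_relations \<kappa> \<tau> H R u v)"

end

theory Submission
  imports Defs
begin

text \<open>
  Both quadratic differentials are determined by the one-form $h(v) = \langle f_v, e_3 \rangle$ and the
  conformal factor $r$ of the induced metric: as $e_3$ is Killing, the symmetric part of the derivative
  of $h$ is $\langle \nabla_v f_w, e_3 \rangle$, whose tangential part is read off from $r$, so what is
  left is the second fundamental form times $\mu = (1 \mp |h|^2)^{1/2}$, the modulus of the angle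
  function. In particular everything is invariant under changes of model charts. The twin relations
  say that the form of the dual surface is $h$ composed with the rotation $J$, and that its conformal
  factor is $r \mu^2$. Computing the curl of both forms from the bundle curvatures $\tau$ and $H$ gives
  the derivative of $\mu$, and with it the difference of the two Hopf differentials, multiplied by $a$
  and $- i a$, as $- 2 (H - i \tau) a h^2$. This cancels against the terms in $h^2$, as the hypotheses on
  the coefficients amount to $b + b' = 2 (H - i \tau) a$.
\<close>

section \<open>Second derivatives\<close>

text \<open>Duality supplies only one pair of model charts near each point, both over the same base
  chart, whereas the claim quantifies over all pairs; so the identity is proved in the dual charts
  and then carried over. A conformal parameter need not induce the orientation lifted from the base,
  so J is multiplication by \<epsilon> i with a locally constant sign \<epsilon> that every formula
  has to carry; its independence of the chart rests on the base charts being related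
  holomorphically. The two spaces form one family, \<open>kmetric\<close> with s = <e3, e3>: s = 1,
  t = \<tau> and s = -1, t = - H, so facts about a single surface are proved once. The divergence of
  the one-form of X is, up to sign, the curl of its rotation, which belongs to the dual surface;
  this is how H enters beside \<tau>. The hypothesis \<open>degenerate\<close> concerns \<kappa> =
  \<tau> = H = 0: there the linear conditions hold for all b and b', while the identity forces b +
  b' = 0 as soon as e3 is somewhere not normal to the surface.\<close>

text \<open>The mean value theorem in direction v turns the second difference into a difference of
  values of \<open>D f\<close> in direction v. Expanding these to first order at z needs
  differentiability of that function at the single point z only. A one-sided limit is enough for
  comparing limits.\<close>

lemma second_difference_quotient_tendsto:
  fixes f :: "'a::real_normed_vector \<Rightarrow> real"
  assumes "open S" "z \<in> S" and f: "\<And>x. x \<in> S \<Longrightarrow> f differentiable (at x)"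
    and F: "(\<lambda>x. D f x v) differentiable (at z)"
  shows "((\<lambda>h. (f (z + h *\<^sub>R v + h *\<^sub>R w) - f (z + h *\<^sub>R v) - f (z + h *\<^sub>R w) + f z) / h\<^sup>2)
           \<longlongrightarrow> D (\<lambda>x. D f x v) z w) (at_right 0)"
proof (rule tendstoI)
  fix e :: real assume "e > 0"
  define F where "F = (\<lambda>x. D f x v)"
  define F' where "F' = D F z"
  \<comment> \<open>The remainders at t v + h w and at t v add up to at most e / K * h * (2 |v| +
    |w|); the extra 1 makes K positive and the final estimate strict.\<close>
  define K where "K = 2 * norm v + norm w + 1"
  have K: "K > 0" by (simp add: K_def add_nonneg_pos)
  have dF: "(F has_derivative F') (at z)"
    using F unfolding F_def F'_def by (simp add: frechet_derivative_works)
  obtain d where d: "d > 0"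
    "\<And>y. norm (y - z) < d \<Longrightarrow> norm (F y - F z - F' (y - z)) \<le> e / K * norm (y - z)"
    using dF \<open>e > 0\<close> K unfolding has_derivative_at_alt by (metis divide_pos_pos)
  obtain r where r: "r > 0" "ball z r \<subseteq> S" using assms(1,2) open_contains_ball by metis
  have lin: "linear F'" using dF by (simp add: has_derivative_linear)
  have "\<forall>\<^sub>F h in at_right 0. h < min d r / K"
    using d(1) r(1) K by (intro eventually_at_rightI[of 0 "min d r / K"]) auto
  moreover have "\<forall>\<^sub>F h::real in at_right 0. 0 < h" by (simp add: eventually_at_right_less)
  ultimately show "\<forall>\<^sub>F h in at_right 0.
      dist ((f (z + h *\<^sub>R v + h *\<^sub>R w) - f (z + h *\<^sub>R v) - f (z + h *\<^sub>R w) + f z) / h\<^sup>2)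
           (D (\<lambda>x. D f x v) z w) < e"
  proof eventually_elim
    case (elim h)
    have small: "norm (t *\<^sub>R v + c *\<^sub>R w) < min d r" "norm (t *\<^sub>R v + c *\<^sub>R w) \<le> h * (norm v + norm w)"
      if "0 \<le> t" "t \<le> h" "0 \<le> c" "c \<le> h" for t c
    proof -
      have "norm (t *\<^sub>R v + c *\<^sub>R w) \<le> t * norm v + c * norm w"
        using norm_triangle_ineq[of "t *\<^sub>R v" "c *\<^sub>R w"] that by simp
      also have "\<dots> \<le> h * norm v + h * norm w"
        using that by (intro add_mono mult_right_mono) auto
      finally show *: "norm (t *\<^sub>R v + c *\<^sub>R w) \<le> h * (norm v + norm w)"
        by (simp add: distrib_left)
      also have "\<dots> < h * K" using elim by (intro mult_strict_left_mono) (auto simp: K_def add_nonneg_pos)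
      also have "\<dots> < min d r" using elim K by (simp add: pos_less_divide_eq)
      finally show "norm (t *\<^sub>R v + c *\<^sub>R w) < min d r" .
    qed
    have der: "((\<lambda>t. f (z + t *\<^sub>R v + c *\<^sub>R w)) has_real_derivative F (z + t *\<^sub>R v + c *\<^sub>R w)) (at t)"
      if "0 \<le> t" "t \<le> h" "0 \<le> c" "c \<le> h" for t c
    proof -
      have "z + t *\<^sub>R v + c *\<^sub>R w \<in> ball z r"
        using small(1)[OF that] norm_minus_cancel[of "t *\<^sub>R v + c *\<^sub>R w"]
        by (simp add: dist_norm add.assoc del: norm_minus_cancel)
      then have "(f has_derivative D f (z + t *\<^sub>R v + c *\<^sub>R w)) (at (z + t *\<^sub>R v + c *\<^sub>R w))"
        using f r by (auto simp: frechet_derivative_works)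
      moreover from this have "linear (D f (z + t *\<^sub>R v + c *\<^sub>R w))"
        by (rule has_derivative_linear)
      moreover have "((\<lambda>t. z + t *\<^sub>R v + c *\<^sub>R w) has_derivative (\<lambda>x. x *\<^sub>R v)) (at t)"
        by (auto intro!: derivative_eq_intros)
      ultimately have "((\<lambda>t. f (z + t *\<^sub>R v + c *\<^sub>R w)) has_derivative
          (\<lambda>x. x * D f (z + t *\<^sub>R v + c *\<^sub>R w) v)) (at t)"
        using has_derivative_compose[of "\<lambda>t. z + t *\<^sub>R v + c *\<^sub>R w" _ t UNIV f] by (force simp: linear_cmul)
      then show ?thesis
        unfolding F_def has_field_derivative_def by (simp add: mult.commute[of _ "D f _ v"])
    qed
    obtain t where t: "0 < t" "t < h"
      and eq: "(f (z + h *\<^sub>R v + h *\<^sub>R w) - f (z + h *\<^sub>R v)) - (f (z + 0 *\<^sub>R v + h *\<^sub>R w) - f (z + 0 *\<^sub>R v))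
        = (h - 0) * (F (z + t *\<^sub>R v + h *\<^sub>R w) - F (z + t *\<^sub>R v))"
    proof -
      have "\<exists>t>0. t < h \<and> (\<lambda>t. f (z + t *\<^sub>R v + h *\<^sub>R w) - f (z + t *\<^sub>R v)) h -
          (\<lambda>t. f (z + t *\<^sub>R v + h *\<^sub>R w) - f (z + t *\<^sub>R v)) 0
        = (h - 0) * (F (z + t *\<^sub>R v + h *\<^sub>R w) - F (z + t *\<^sub>R v))"
        using elim der[of _ h] der[of _ 0] by (intro MVT2 DERIV_diff) auto
      then show thesis using that by auto
    qed
    define R where "R = (\<lambda>y. F (z + y) - F z - F' y)"
    have R: "\<bar>R y\<bar> \<le> e / K * norm y" if "norm y < d" for y
      using d(2)[of "z + y"] that by (simp add: R_def)
    have R1: "\<bar>R (t *\<^sub>R v + h *\<^sub>R w)\<bar> \<le> e / K * (h * (norm v + norm w))"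
      using R[of "t *\<^sub>R v + h *\<^sub>R w"] small[of t h] t elim \<open>e > 0\<close> K
      by (smt (verit) divide_pos_pos mult_left_mono)
    have "norm (t *\<^sub>R v) \<le> h * norm v" using t by (simp add: mult_right_mono)
    then have R2: "\<bar>R (t *\<^sub>R v)\<bar> \<le> e / K * (h * norm v)"
      using R[of "t *\<^sub>R v"] small[of t 0] t elim \<open>e > 0\<close> K
      by (smt (verit) divide_pos_pos mult_left_mono scale_zero_left add.right_neutral)
    have "F (z + t *\<^sub>R v + h *\<^sub>R w) - F (z + t *\<^sub>R v) = h * F' w + (R (t *\<^sub>R v + h *\<^sub>R w) - R (t *\<^sub>R v))"
      by (simp add: R_def linear_add[OF lin] linear_cmul[OF lin] add.assoc)
    from eq[unfolded this] have "(f (z + h *\<^sub>R v + h *\<^sub>R w) - f (z + h *\<^sub>R v) - f (z + h *\<^sub>R w) + f z) / h\<^sup>2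
        = h * (h * F' w + (R (t *\<^sub>R v + h *\<^sub>R w) - R (t *\<^sub>R v))) / h\<^sup>2"
      by (simp add: algebra_simps)
    also have "\<dots> = F' w + (R (t *\<^sub>R v + h *\<^sub>R w) - R (t *\<^sub>R v)) / h"
      using elim by (simp add: add_divide_distrib power2_eq_square)
    finally have "(f (z + h *\<^sub>R v + h *\<^sub>R w) - f (z + h *\<^sub>R v) - f (z + h *\<^sub>R w) + f z) / h\<^sup>2
        = F' w + (R (t *\<^sub>R v + h *\<^sub>R w) - R (t *\<^sub>R v)) / h" .
    moreover have "\<bar>(R (t *\<^sub>R v + h *\<^sub>R w) - R (t *\<^sub>R v)) / h\<bar> < e"
    proof -
      have "\<bar>R (t *\<^sub>R v + h *\<^sub>R w) - R (t *\<^sub>R v)\<bar> \<le> e / K * (h * (K - 1))"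
      proof -
        have "h * (K - 1) = h * (norm v + norm w) + h * norm v"
          by (simp add: K_def algebra_simps)
        then show ?thesis using R1 R2 by (simp only: distrib_left[of "e / K"])
      qed
      also have "\<dots> < e / K * (h * K)"
        using \<open>e > 0\<close> K elim by (intro mult_strict_left_mono) auto
      finally show ?thesis using K elim by (simp add: abs_divide pos_divide_less_eq)
    qed
    ultimately show ?case by (simp add: dist_real_def F_def F'_def)
  qed
qed

text \<open>The second difference is symmetric in v and w, so both mixed derivatives are limits of
  the same quotient.\<close>

lemma mixed_derivatives_commute_real:
  fixes f :: "'a::real_normed_vector \<Rightarrow> real"
  assumes "open S" "z \<in> S" "\<And>x. x \<in> S \<Longrightarrow> f differentiable (at x)"
    and "(\<lambda>x. D f x v) differentiable (at z)" "(\<lambda>x. D f x w) differentiable (at z)"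
  shows "D (\<lambda>x. D f x v) z w = D (\<lambda>x. D f x w) z v"
proof (rule tendsto_unique[OF trivial_limit_at_right_real])
  let ?q = "\<lambda>h. (f (z + h *\<^sub>R v + h *\<^sub>R w) - f (z + h *\<^sub>R v) - f (z + h *\<^sub>R w) + f z) / h\<^sup>2"
  show "(?q \<longlongrightarrow> D (\<lambda>x. D f x v) z w) (at_right 0)"
    by (rule second_difference_quotient_tendsto) (use assms in auto)
  have "?q = (\<lambda>h. (f (z + h *\<^sub>R w + h *\<^sub>R v) - f (z + h *\<^sub>R w) - f (z + h *\<^sub>R v) + f z) / h\<^sup>2)"
    by (auto simp: algebra_simps)
  then show "(?q \<longlongrightarrow> D (\<lambda>x. D f x w) z v) (at_right 0)"
    using second_difference_quotient_tendsto[OF assms(1-3,5), of v] by simp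
qed

lemma frechet_derivative_eqI: "(f has_derivative f') (at x) \<Longrightarrow> D f x = f'"
  by (simp add: frechet_derivative_at[symmetric])

lemma frechet_derivative_nth:
  fixes f :: "'a::real_normed_vector \<Rightarrow> real^'n"
  assumes "f differentiable (at x)"
  shows "D (\<lambda>x. f x $ i) x v = D f x v $ i" "(\<lambda>x. f x $ i) differentiable (at x)"
proof -
  have "((\<lambda>x. f x $ i) has_derivative (\<lambda>v. D f x v $ i)) (at x)"
    using assms by (intro bounded_linear.has_derivative[OF bounded_linear_vec_nth])
      (simp add: frechet_derivative_works)
  then show "D (\<lambda>x. f x $ i) x v = D f x v $ i" "(\<lambda>x. f x $ i) differentiable (at x)"
    by (auto simp: frechet_derivative_eqI differentiable_def)
qed

lemma mixed_derivatives_commute: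
  fixes f :: "'a::real_normed_vector \<Rightarrow> real^'n"
  assumes "open S" "z \<in> S" and f: "\<And>x. x \<in> S \<Longrightarrow> f differentiable (at x)"
    and v: "(\<lambda>x. D f x v) differentiable (at z)" and w: "(\<lambda>x. D f x w) differentiable (at z)"
  shows "D (\<lambda>x. D f x v) z w = D (\<lambda>x. D f x w) z v"
proof -
  have *: "D (\<lambda>x. D (\<lambda>x. f x $ i) x u) z t = D (\<lambda>x. D f x u) z t $ i
      \<and> (\<lambda>x. D (\<lambda>x. f x $ i) x u) differentiable (at z)"
    if u: "(\<lambda>x. D f x u) differentiable (at z)" for u t i
  proof -
    have "((\<lambda>x. D f x u $ i) has_derivative (\<lambda>t. D (\<lambda>x. D f x u) z t $ i)) (at z)"
      using u by (intro bounded_linear.has_derivative[OF bounded_linear_vec_nth])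
        (simp add: frechet_derivative_works)
    then have "((\<lambda>x. D (\<lambda>x. f x $ i) x u) has_derivative (\<lambda>t. D (\<lambda>x. D f x u) z t $ i)) (at z)"
      using assms(1,2) by (rule has_derivative_transform_within_open)
        (simp add: frechet_derivative_nth(1)[OF f])
    then show ?thesis by (auto simp: frechet_derivative_eqI differentiable_def)
  qed
  have "D (\<lambda>x. D (\<lambda>x. f x $ i) x v) z w = D (\<lambda>x. D (\<lambda>x. f x $ i) x w) z v" for i
    using assms(1,2) frechet_derivative_nth(2)[OF f] *[OF v] *[OF w]
    by (intro mixed_derivatives_commute_real) auto
  then show ?thesis using *[OF v] *[OF w] by (simp add: vec_eq_iff)
qed

section \<open>Conformal surfaces in a space with a Killing field\<close>

text \<open>What the model metrics of both signatures share. Since the Killing field is the constant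
  field \<open>e3\<close>, the Killing equation says that the metric coefficients are constant along
  \<open>e3\<close>; s is the causal sign of \<open>e3\<close>.\<close>

locale killing_metric =
  fixes g :: metric and P :: "(real^3) set" and s :: real
  assumes g_bilinear: "bilinear (g p)"
    and g_sym: "g p u v = g p v u"
    and g_nondeg: "p \<in> P \<Longrightarrow> det (metric_matrix g p) \<noteq> 0"
    and g_differentiable: "p \<in> P \<Longrightarrow> (\<lambda>q. g q u v) differentiable (at p)"
    and g_killing: "p \<in> P \<Longrightarrow> D (\<lambda>q. g q u v) p e3 = 0"
    and g_e3: "g p e3 e3 = s"
    and s_square: "s * s = 1"
begin

definition dg :: "real^3 \<Rightarrow> real^3 \<Rightarrow> real^3 \<Rightarrow> real^3 \<Rightarrow> real" where
  "dg p x u v = D (\<lambda>q. g q u v) p x"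

lemmas g_simps = bilinear_ladd[OF g_bilinear] bilinear_radd[OF g_bilinear]
  bilinear_lmul[OF g_bilinear] bilinear_rmul[OF g_bilinear] bilinear_lneg[OF g_bilinear]
  bilinear_rneg[OF g_bilinear] bilinear_lsub[OF g_bilinear] bilinear_rsub[OF g_bilinear]
  bilinear_lzero[OF g_bilinear] bilinear_rzero[OF g_bilinear]

lemma vec_expand: "(u::real^3) = (\<Sum>i\<in>UNIV. u $ i *\<^sub>R axis i 1)"
  by (simp add: vec_eq_iff axis_def if_distrib cong: if_cong)

lemma g_expand: "g p u v = (\<Sum>j\<in>UNIV. \<Sum>k\<in>UNIV. u $ j * v $ k * g p (axis j 1) (axis k 1))"
  by (subst vec_expand[of u], subst vec_expand[of v])
    (simp add: bilinear_sum[OF g_bilinear] sum.cartesian_product g_simps mult_ac)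

lemma dg_has_derivative: "p \<in> P \<Longrightarrow> ((\<lambda>q. g q u v) has_derivative (\<lambda>x. dg p x u v)) (at p)"
  unfolding dg_def using g_differentiable by (simp add: frechet_derivative_works[symmetric])

lemma dg_expand:
  assumes "p \<in> P"
  shows "dg p x u v = (\<Sum>j\<in>UNIV. \<Sum>k\<in>UNIV. u $ j * v $ k * dg p x (axis j 1) (axis k 1))"
proof -
  have "((\<lambda>q. \<Sum>j\<in>UNIV. \<Sum>k\<in>UNIV. u $ j * v $ k * g q (axis j 1) (axis k 1)) has_derivative
    (\<lambda>x. \<Sum>j\<in>UNIV. \<Sum>k\<in>UNIV. u $ j * v $ k * dg p x (axis j 1) (axis k 1))) (at p)"
    using assms by (intro has_derivative_sum has_derivative_mult_right dg_has_derivative)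
  then have "((\<lambda>q. g q u v) has_derivative
    (\<lambda>x. \<Sum>j\<in>UNIV. \<Sum>k\<in>UNIV. u $ j * v $ k * dg p x (axis j 1) (axis k 1))) (at p)"
    by (subst (asm) g_expand[symmetric])
  from frechet_derivative_eqI[OF this] show ?thesis by (simp add: dg_def)
qed

lemma dg_linear: "p \<in> P \<Longrightarrow> linear (\<lambda>x. dg p x u v)"
  using has_derivative_linear[OF dg_has_derivative] .

lemma dg_expand_direction:
  assumes "p \<in> P"
  shows "dg p x u v = (\<Sum>i\<in>UNIV. x $ i * dg p (axis i 1) u v)"
  using linear_sum[OF dg_linear[OF assms], of "\<lambda>i. x $ i *\<^sub>R axis i 1" UNIV]
  by (simp add: linear_cmul[OF dg_linear[OF assms]] vec_expand[symmetric])

lemma dg_expand_all: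
  assumes "p \<in> P"
  shows "dg p x u v = (\<Sum>i\<in>UNIV. \<Sum>j\<in>UNIV. \<Sum>k\<in>UNIV.
    x $ i * u $ j * v $ k * dg p (axis i 1) (axis j 1) (axis k 1))"
  by (subst dg_expand_direction[OF assms], subst dg_expand[OF assms])
    (simp add: sum_distrib_left mult.assoc)

lemma dg_e3: "p \<in> P \<Longrightarrow> dg p e3 u v = 0"
  by (simp add: dg_def g_killing)

text \<open>Leibniz rule for a metric along a map. Expansion in the standard basis reduces it to
  products of real functions.\<close>

lemma has_derivative_g:
  assumes "f z \<in> P" and f: "(f has_derivative f') (at z)"
    and U: "(U has_derivative U') (at z)" and V: "(V has_derivative V') (at z)"
  shows "((\<lambda>z. g (f z) (U z) (V z)) has_derivative
    (\<lambda>v. dg (f z) (f' v) (U z) (V z) + g (f z) (U' v) (V z) + g (f z) (U z) (V' v))) (at z)"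
proof -
  have G: "((\<lambda>z. g (f z) a b) has_derivative (\<lambda>v. dg (f z) (f' v) a b)) (at z)" for a b
    using has_derivative_compose[OF f] dg_has_derivative[OF assms(1)] by fastforce
  have n: "((\<lambda>z. h z $ i) has_derivative (\<lambda>v. h' v $ i)) (at z)"
    if "(h has_derivative h') (at z)" for h h' and i :: 3
    using that by (rule bounded_linear.has_derivative[OF bounded_linear_vec_nth])
  have "((\<lambda>z. \<Sum>j\<in>UNIV. \<Sum>k\<in>UNIV. U z $ j * V z $ k * g (f z) (axis j 1) (axis k 1)) has_derivative
     (\<lambda>v. \<Sum>j\<in>UNIV. \<Sum>k\<in>UNIV. U z $ j * V z $ k * dg (f z) (f' v) (axis j 1) (axis k 1) +
        (U z $ j * V' v $ k + U' v $ j * V z $ k) * g (f z) (axis j 1) (axis k 1))) (at z)"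
    by (intro has_derivative_sum has_derivative_mult n G U V)
  moreover have "(\<Sum>j\<in>UNIV. \<Sum>k\<in>UNIV. U z $ j * V z $ k * dg (f z) (f' v) (axis j 1) (axis k 1) +
        (U z $ j * V' v $ k + U' v $ j * V z $ k) * g (f z) (axis j 1) (axis k 1))
    = dg (f z) (f' v) (U z) (V z) + g (f z) (U' v) (V z) + g (f z) (U z) (V' v)" for v
    by (subst dg_expand[OF assms(1), of _ "U z" "V z"], subst g_expand[of _ "U' v"],
        subst g_expand[of _ "U z" "V' v"])
      (simp add: sum.distrib distrib_right)
  ultimately show ?thesis by (subst g_expand) simp
qed

section \<open>The Levi-Civita connection and the Koszul formula\<close>

definition connection :: "real^3 \<Rightarrow> real^3 \<Rightarrow> real^3 \<Rightarrow> real^3" where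
  "connection p x u = (\<chi> k. \<Sum>i\<in>UNIV. \<Sum>j\<in>UNIV. christoffel g p k i j * (x $ i * u $ j))"

text \<open>Pairing with a basis vector lowers the upper index of the Christoffel symbols, and the
  metric matrix cancels the inverse matrix contained in them.\<close>

lemma connection_axis:
  assumes "p \<in> P"
  shows "2 * g p (connection p x u) (axis m 1) =
    dg p x u (axis m 1) + dg p u x (axis m 1) - dg p (axis m 1) x u"
proof -
  let ?M = "metric_matrix g p"
  have M: "?M $ m $ k = g p (axis k 1) (axis m 1)" for k
    by (simp add: metric_matrix_def g_sym)
  have dM: "d_metric g p i j l = dg p (axis i 1) (axis j 1) (axis l 1)" for i j l
    by (simp add: d_metric_def metric_matrix_def dg_def)
  define c where "c i j l = dg p (axis i 1) (axis j 1) (axis l 1) + dg p (axis j 1) (axis i 1) (axis l 1)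
    - dg p (axis l 1) (axis i 1) (axis j 1)" for i j l :: 3
  \<comment> \<open>\<open>matrix_inv\<close> is defined by choice; the nonzero determinant
    guarantees that there is a two-sided inverse to choose.\<close>
  have inv: "?M ** matrix_inv ?M = mat 1"
    using g_nondeg[OF assms] someI_ex[of "\<lambda>A'. ?M ** A' = mat 1 \<and> A' ** ?M = mat 1"]
    by (auto simp: invertible_det_nz[symmetric] invertible_def matrix_inv_def)
  have inv': "(\<Sum>k\<in>UNIV. ?M $ m $ k * matrix_inv ?M $ k $ l) = (if m = l then 1 else 0)" for l
    using arg_cong[OF inv, of "\<lambda>A. A $ m $ l"] by (simp add: matrix_matrix_mult_def mat_def)
  have chr: "(\<Sum>k\<in>UNIV. ?M $ m $ k * christoffel g p k i j) = c i j m / 2" for i j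
  proof -
    have "(\<Sum>k\<in>UNIV. ?M $ m $ k * christoffel g p k i j)
      = (\<Sum>k\<in>UNIV. \<Sum>l\<in>UNIV. ?M $ m $ k * matrix_inv ?M $ k $ l * c i j l) / 2"
      by (simp add: christoffel_def dM c_def sum_distrib_left sum_divide_distrib mult.assoc)
    also have "\<dots> = (\<Sum>l\<in>UNIV. (\<Sum>k\<in>UNIV. ?M $ m $ k * matrix_inv ?M $ k $ l) * c i j l) / 2"
      by (subst sum.swap) (simp add: sum_distrib_right)
    also have "\<dots> = c i j m / 2"
      by (simp add: inv' if_distrib[of "\<lambda>x. x * _"] cong: if_cong)
    finally show ?thesis .
  qed
  have "g p (connection p x u) (axis m 1) = (\<Sum>k\<in>UNIV. connection p x u $ k * ?M $ m $ k)"
    by (subst g_expand) (simp add: M axis_def if_distrib[of "\<lambda>x. _ * x"] if_distrib[of "\<lambda>x. x * _"] cong: if_cong)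
  also have "\<dots> = (\<Sum>k\<in>UNIV. \<Sum>i\<in>UNIV. \<Sum>j\<in>UNIV. x $ i * u $ j * (?M $ m $ k * christoffel g p k i j))"
    by (simp add: connection_def sum_distrib_left sum_distrib_right mult_ac)
  also have "\<dots> = (\<Sum>i\<in>UNIV. \<Sum>j\<in>UNIV. \<Sum>k\<in>UNIV. x $ i * u $ j * (?M $ m $ k * christoffel g p k i j))"
    by (subst sum.swap) (subst (2) sum.swap, simp)
  also have "\<dots> = (\<Sum>i\<in>UNIV. \<Sum>j\<in>UNIV. x $ i * u $ j * (c i j m / 2))"
    by (simp add: sum_distrib_left[symmetric] chr)
  finally have "2 * g p (connection p x u) (axis m 1) = (\<Sum>i\<in>UNIV. \<Sum>j\<in>UNIV. x $ i * u $ j * c i j m)"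
    by (simp add: sum_distrib_left)
  also have "\<dots> = dg p x u (axis m 1) + dg p u x (axis m 1) - dg p (axis m 1) x u"
  proof -
    have e: "(\<Sum>k\<in>UNIV. a k * axis m 1 $ k * b k) = a m * b m" for a b :: "3 \<Rightarrow> real"
      by (simp add: axis_def if_distrib[of "\<lambda>x. _ * x"] if_distrib[of "\<lambda>x. x * _"] cong: if_cong)
    have 1: "dg p x u (axis m 1) = (\<Sum>i\<in>UNIV. \<Sum>j\<in>UNIV. x $ i * u $ j * dg p (axis i 1) (axis j 1) (axis m 1))" for x u
      by (subst dg_expand_all[OF assms]) (simp add: e)
    have 2: "dg p u x (axis m 1) = (\<Sum>i\<in>UNIV. \<Sum>j\<in>UNIV. x $ i * u $ j * dg p (axis j 1) (axis i 1) (axis m 1))"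
      unfolding 1[of u x] by (rule trans[OF sum.swap]) (simp add: mult_ac)
    have 3: "dg p (axis m 1) x u = (\<Sum>i\<in>UNIV. \<Sum>j\<in>UNIV. x $ i * u $ j * dg p (axis m 1) (axis i 1) (axis j 1))"
      by (rule dg_expand[OF assms])
    show ?thesis by (simp add: 1[of x u] 2 3 c_def sum.distrib sum_subtractf distrib_left right_diff_distrib)
  qed
  finally show ?thesis .
qed

text \<open>Koszul formula for constant coordinate fields, whose Lie brackets vanish. Both sides are
  linear in y, so basis vectors suffice.\<close>

lemma connection_koszul:
  assumes "p \<in> P"
  shows "2 * g p (connection p x u) y = dg p x u y + dg p u x y - dg p y x u"
proof -
  have r: "g p w y = (\<Sum>m\<in>UNIV. y $ m * g p w (axis m 1))" for w
    by (subst (1) vec_expand[of y])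
      (simp add: linear_sum[OF g_bilinear[unfolded bilinear_def, THEN conjunct1, rule_format]] g_simps)
  have dr: "dg p w w' y = (\<Sum>m\<in>UNIV. y $ m * dg p w w' (axis m 1))" for w w'
    by (subst (1 2) dg_expand[OF assms], subst sum.swap)
      (simp add: sum_distrib_left axis_def if_distrib[of "\<lambda>x. _ * x"] if_distrib[of "\<lambda>x. x * _"] mult_ac cong: if_cong)
  show ?thesis
    by (subst r, subst dr, subst dr, subst dg_expand_direction[OF assms, of y])
      (simp add: sum_distrib_left mult.left_commute[of 2] connection_axis[OF assms] algebra_simps sum.distrib sum_subtractf)
qed

end

lemma det_vector_3:
  "det (vector [a, b, c] :: real^3^3) =
    a$1 * (b$2 * c$3 - b$3 * c$2) - a$2 * (b$1 * c$3 - b$3 * c$1) + a$3 * (b$1 * c$2 - b$2 * c$1)"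
  by (simp add: det_3 algebra_simps)

text \<open>Sign of the Jacobian of the base coordinates: 1 if the parameter induces the orientation
  lifted from the base, -1 if it induces the opposite one. Conformality of the immersion does not
  decide between the two.\<close>

definition base_orientation :: "(complex \<Rightarrow> real^3) \<Rightarrow> complex \<Rightarrow> real" where
  "base_orientation f z = sgn (D f z 1 $ 1 * D f z \<i> $ 2 - D f z 1 $ 2 * D f z \<i> $ 1)"

text \<open>The quotient of the two sides of \<open>transversal\<close> for s = 1 is the squared
  length of the tangential part of \<open>e3\<close>; in the Riemannian case the bound 1 means that
  the surface is nowhere vertical. For s = -1 the left-hand side is nonpositive.\<close>

locale conformal_surface = killing_metric +
  fixes S :: "complex set" and f :: "complex \<Rightarrow> real^3" and r :: "complex \<Rightarrow> real"
  assumes open_S: "open S"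
    and f_differentiable: "z \<in> S \<Longrightarrow> f differentiable (at z)"
    and Df_differentiable: "z \<in> S \<Longrightarrow> (\<lambda>z. D f z v) differentiable (at z)"
    and f_in_P: "z \<in> S \<Longrightarrow> f z \<in> P"
    and conformal: "z \<in> S \<Longrightarrow> g (f z) (D f z v) (D f z w) = r z * (v \<bullet> w)"
    and r_pos: "z \<in> S \<Longrightarrow> r z > 0"
    and transversal: "z \<in> S \<Longrightarrow> s * ((g (f z) (D f z 1) e3)\<^sup>2 + (g (f z) (D f z \<i>) e3)\<^sup>2) < r z"
begin

definition h :: "complex \<Rightarrow> complex \<Rightarrow> real" where
  "h v z = g (f z) (D f z v) e3"

text \<open>Chosen such that \<open>normal\<close> has square s \<mu>^2, so that dividing by \<mu>
  normalizes it.\<close>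

definition \<mu> :: "complex \<Rightarrow> real" where
  "\<mu> z = sqrt (1 - s * ((h 1 z)\<^sup>2 + (h \<i> z)\<^sup>2) / r z)"

text \<open>The component of \<open>e3\<close> orthogonal to the surface: the projection to the
  tangent plane is subtracted, computed in the orthogonal coordinate vectors of square r.\<close>

definition normal :: "complex \<Rightarrow> real^3" where
  "normal z = e3 - (h 1 z / r z) *\<^sub>R D f z 1 - (h \<i> z / r z) *\<^sub>R D f z \<i>"

abbreviation \<epsilon> :: "complex \<Rightarrow> real" where
  "\<epsilon> \<equiv> base_orientation f"

lemma s_abs: "\<bar>s\<bar> = 1"
  using s_square by (auto simp: square_eq_1_iff)

lemma \<mu>_pos: "z \<in> S \<Longrightarrow> \<mu> z > 0"
  using transversal r_pos by (auto simp: \<mu>_def h_def pos_divide_less_eq)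

lemma \<mu>_square: "z \<in> S \<Longrightarrow> (\<mu> z)\<^sup>2 = 1 - s * ((h 1 z)\<^sup>2 + (h \<i> z)\<^sup>2) / r z"
  using \<mu>_pos[of z] by (simp add: \<mu>_def)

lemma Df_linear: "z \<in> S \<Longrightarrow> linear (D f z)"
  using f_differentiable by (rule linear_frechet_derivative)

lemma Df_expand:
  assumes "z \<in> S" shows "D f z v = Re v *\<^sub>R D f z 1 + Im v *\<^sub>R D f z \<i>"
proof -
  have "v = Re v *\<^sub>R 1 + Im v *\<^sub>R \<i>" by (simp add: complex_eq_iff)
  then show ?thesis using linear_add[OF Df_linear[OF assms]] linear_cmul[OF Df_linear[OF assms]] by metis
qed

lemma h_expand: "z \<in> S \<Longrightarrow> h v z = Re v * h 1 z + Im v * h \<i> z"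
  unfolding h_def by (subst Df_expand) (auto simp: g_simps)

lemma conformal_basis:
  assumes "z \<in> S"
  shows "g (f z) (D f z 1) (D f z 1) = r z" "g (f z) (D f z \<i>) (D f z \<i>) = r z"
    "g (f z) (D f z 1) (D f z \<i>) = 0" "g (f z) (D f z \<i>) (D f z 1) = 0"
  using assms by (simp_all add: conformal)

lemma g_normal:
  assumes "z \<in> S"
  shows "g (f z) (normal z) (D f z v) = 0" "g (f z) (D f z v) (normal z) = 0"
    "g (f z) (normal z) (normal z) = s * (\<mu> z)\<^sup>2" "g (f z) (normal z) e3 = s * (\<mu> z)\<^sup>2"
proof -
  have r: "r z \<noteq> 0" using r_pos[OF assms] by simp
  have b: "g (f z) (normal z) (D f z 1) = 0" "g (f z) (normal z) (D f z \<i>) = 0"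
    unfolding normal_def using r
    by (simp_all add: g_simps conformal_basis[OF assms] g_sym[of _ e3] h_def)
  show 1: "g (f z) (normal z) (D f z v) = 0" for v
    by (subst Df_expand[OF assms]) (simp add: g_simps b)
  then show "g (f z) (D f z v) (normal z) = 0" by (simp add: g_sym)
  show 2: "g (f z) (normal z) e3 = s * (\<mu> z)\<^sup>2"
  proof -
    have "g (f z) (normal z) e3 = s - (h 1 z / r z) * h 1 z - (h \<i> z / r z) * h \<i> z"
      by (simp add: normal_def g_simps g_e3 h_def)
    also have "\<dots> = s * (1 - s * ((h 1 z)\<^sup>2 + (h \<i> z)\<^sup>2) / r z)"
      using r s_square by (simp add: field_simps power2_eq_square)
        (simp add: mult.assoc[symmetric] distrib_left[symmetric])
    finally show ?thesis by (simp add: \<mu>_square[OF assms])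
  qed
  have "g (f z) (normal z) (normal z) = g (f z) (normal z) e3"
    by (subst (2) normal_def) (simp add: g_simps b)
  then show "g (f z) (normal z) (normal z) = s * (\<mu> z)\<^sup>2" using 2 by simp
qed

text \<open>The pairings with the frame form a linear map A with an explicit right inverse. In
  dimension three A is then injective as well, so the right inverse recovers x.\<close>

lemma frame_expand:
  assumes "z \<in> S" obtains a b c where "x = a *\<^sub>R D f z 1 + b *\<^sub>R D f z \<i> + c *\<^sub>R normal z"
proof -
  define A :: "real^3 \<Rightarrow> real^3" where
    "A x = vector [g (f z) x (D f z 1), g (f z) x (D f z \<i>), g (f z) x (normal z)]" for x
  have n: "s * (\<mu> z)\<^sup>2 \<noteq> 0" using \<mu>_pos[OF assms] s_square by auto
  have r: "r z \<noteq> 0" using r_pos[OF assms] by simp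
  have A: "linear A"
    by (rule linearI) (simp_all add: A_def vec_eq_iff forall_3 g_simps)
  let ?B = "\<lambda>y::real^3. (y $ 1 / r z) *\<^sub>R D f z 1 + (y $ 2 / r z) *\<^sub>R D f z \<i> +
    (y $ 3 / (s * (\<mu> z)\<^sup>2)) *\<^sub>R normal z"
  have AB: "A (?B y) = y" for y
    using n r by (simp add: A_def vec_eq_iff forall_3 g_simps conformal_basis[OF assms] g_normal[OF assms])
  then have "surj A" by (rule surjI)
  then have "inj A" using A by (simp add: linear_surjective_imp_injective)
  then have "x = ?B (A x)" using AB by (metis injD)
  then show thesis by (rule that)
qed

lemma g_cancel:
  assumes "z \<in> S" "\<And>w. g (f z) x w = g (f z) y w" shows "x = y"
proof -
  obtain a b c where x: "x - y = a *\<^sub>R D f z 1 + b *\<^sub>R D f z \<i> + c *\<^sub>R normal z"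
    using frame_expand[OF assms(1)] .
  have "g (f z) (x - y) w = 0" for w using assms(2) by (simp add: g_simps)
  from this[of "D f z 1"] this[of "D f z \<i>"] this[of "normal z"]
  have "a = 0" "b = 0" "c = 0"
    using r_pos[OF assms(1)] \<mu>_pos[OF assms(1)] s_square
    unfolding x by (auto simp: g_simps conformal_basis[OF assms(1)] g_normal[OF assms(1)])
  then show ?thesis using x by simp
qed

text \<open>Settles the definite description: orthogonality leaves the multiples of
  \<open>normal\<close>, unit length leaves two of them, and the sign of the component along
  \<open>e3\<close> picks one. Dividing by <e3, e3> makes this sign positive in both
  signatures.\<close>

lemma unit_normal_eq:
  assumes "z \<in> S"
  shows "unit_normal g f z = (1 / \<mu> z) *\<^sub>R normal z"
  unfolding unit_normal_def
proof (rule the_equality)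
  have \<mu>: "\<mu> z > 0" by (rule \<mu>_pos[OF assms])
  have s: "\<bar>s\<bar> = 1" "s \<noteq> 0" using s_abs by auto
  show "(\<forall>v. g (f z) ((1 / \<mu> z) *\<^sub>R normal z) (D f z v) = 0) \<and>
    \<bar>g (f z) ((1 / \<mu> z) *\<^sub>R normal z) ((1 / \<mu> z) *\<^sub>R normal z)\<bar> = 1 \<and>
    0 < g (f z) ((1 / \<mu> z) *\<^sub>R normal z) e3 / g (f z) e3 e3"
    using \<mu> s by (simp add: g_simps g_normal[OF assms] g_e3 power2_eq_square abs_mult)
  fix n
  assume n: "(\<forall>v. g (f z) n (D f z v) = 0) \<and> \<bar>g (f z) n n\<bar> = 1 \<and> 0 < g (f z) n e3 / g (f z) e3 e3"
  obtain a b c where x: "n = a *\<^sub>R D f z 1 + b *\<^sub>R D f z \<i> + c *\<^sub>R normal z"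
    using frame_expand[OF assms] .
  have "g (f z) n (D f z 1) = 0" "g (f z) n (D f z \<i>) = 0" using n by auto
  then have "a = 0" "b = 0" using r_pos[OF assms]
    unfolding x by (auto simp: g_simps conformal_basis[OF assms] g_normal[OF assms])
  then have x: "n = c *\<^sub>R normal z" using x by simp
  have "c * (s * (\<mu> z)\<^sup>2) / s > 0" using n unfolding x by (simp add: g_simps g_normal[OF assms] g_e3)
  then have c: "c > 0" using s \<mu> by (simp add: zero_less_mult_iff)
  have "\<bar>g (f z) n n\<bar> = 1" using n by blast
  then have "\<bar>c * (c * (s * (\<mu> z)\<^sup>2))\<bar> = 1"
    unfolding x by (simp add: g_simps g_normal[OF assms])
  then have "(c * \<mu> z)\<^sup>2 = 1" using c \<mu> s by (simp add: abs_mult power2_eq_square mult_ac)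
  then have "c * \<mu> z = 1" using c \<mu> by (simp add: power2_eq_1_iff) (smt (verit) mult_pos_pos)
  then have "c = 1 / \<mu> z" using \<mu> by (simp add: field_simps)
  then show "n = (1 / \<mu> z) *\<^sub>R normal z" using x by simp
qed

text \<open>The Gram determinant of \<open>normal\<close> and the coordinate vectors is s \<mu>^2
  r^2. As \<open>normal\<close> differs from \<open>e3\<close> by tangent vectors, the determinant
  of this frame is the Jacobian of the base coordinates.\<close>

lemma det_metric_matrix:
  assumes "z \<in> S"
  shows "sqrt \<bar>det (metric_matrix g (f z))\<bar> * (D f z 1 $ 1 * D f z \<i> $ 2 - D f z 1 $ 2 * D f z \<i> $ 1)
    = \<epsilon> z * \<mu> z * r z"
    and "\<epsilon> z * \<epsilon> z = 1"
proof -
  let ?M = "metric_matrix g (f z)"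
  let ?B = "vector [normal z, D f z 1, D f z \<i>] :: real^3^3"
  let ?d = "D f z 1 $ 1 * D f z \<i> $ 2 - D f z 1 $ 2 * D f z \<i> $ 1"
  have gB: "(?B ** ?M ** transpose ?B) $ i $ j = g (f z) (?B $ i) (?B $ j)" for i j
    unfolding g_expand[of _ "?B $ i"]
    by (subst sum.swap)
      (simp add: matrix_matrix_mult_def transpose_def metric_matrix_def sum_distrib_left sum_distrib_right mult_ac)
  have "det (?B ** ?M ** transpose ?B) = s * (\<mu> z)\<^sup>2 * r z * r z"
    unfolding det_3 gB by (simp add: conformal_basis[OF assms] g_normal[OF assms])
  then have 1: "det ?B * det ?B * det ?M = s * (\<mu> z)\<^sup>2 * r z * r z"
    by (simp add: det_mul mult_ac)
  define d where "d = ?d"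
  have "det ?B = d"
    unfolding det_vector_3 normal_def d_def
    by (simp add: e3_def axis_def right_diff_distrib left_diff_distrib)
  then have "d\<^sup>2 * det ?M = s * (\<mu> z * r z)\<^sup>2" using 1 by (simp add: power2_eq_square mult_ac)
  then have "\<bar>d\<^sup>2 * det ?M\<bar> = \<bar>s * (\<mu> z * r z)\<^sup>2\<bar>" by (rule arg_cong)
  then have "\<bar>det ?M\<bar> * d\<^sup>2 = (\<mu> z * r z)\<^sup>2" by (simp add: abs_mult s_abs mult.commute)
  then have "sqrt (\<bar>det ?M\<bar> * d\<^sup>2) = \<mu> z * r z"
    using \<mu>_pos[OF assms] r_pos[OF assms] by simp
  then have 2: "sqrt \<bar>det ?M\<bar> * \<bar>d\<bar> = \<mu> z * r z" by (simp add: real_sqrt_mult)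
  then have "d \<noteq> 0" using \<mu>_pos[OF assms] r_pos[OF assms] by auto
  have \<epsilon>: "\<epsilon> z = sgn d" by (simp add: base_orientation_def d_def)
  show "\<epsilon> z * \<epsilon> z = 1" using \<open>d \<noteq> 0\<close> by (simp add: \<epsilon> sgn_if)
  have "sqrt \<bar>det ?M\<bar> * d = sgn d * (sqrt \<bar>det ?M\<bar> * \<bar>d\<bar>)"
    by (simp add: abs_if sgn_if)
  then have "sqrt \<bar>det ?M\<bar> * d = \<epsilon> z * \<mu> z * r z" by (simp only: 2 \<epsilon> mult.assoc)
  then show "sqrt \<bar>det ?M\<bar> * ?d = \<epsilon> z * \<mu> z * r z" unfolding d_def .
qed

text \<open>By \<open>g_cancel\<close> the definite description of the cross product is settled by
  pairing with the frame. The volume form on the frame is known from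
  \<open>det_metric_matrix\<close>, which is where the sign comes from.\<close>

lemma rot_J_eq:
  assumes "z \<in> S"
  shows "rot_J g f z (D f z v) = \<epsilon> z *\<^sub>R D f z (\<i> * v)"
proof -
  let ?K = "sqrt \<bar>det (metric_matrix g (f z))\<bar>"
  let ?d = "D f z 1 $ 1 * D f z \<i> $ 2 - D f z 1 $ 2 * D f z \<i> $ 1"
  have *: "g (f z) (\<epsilon> z *\<^sub>R D f z (\<i> * v)) w =
      ?K * det (vector [unit_normal g f z, D f z v, w] :: real^3^3)" for w
  proof -
    obtain a b c where w: "w = a *\<^sub>R D f z 1 + b *\<^sub>R D f z \<i> + c *\<^sub>R normal z"
      using frame_expand[OF assms] .
    have "g (f z) (\<epsilon> z *\<^sub>R D f z (\<i> * v)) w = \<epsilon> z * (r z * (Re v * b - Im v * a))"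
      unfolding w by (subst Df_expand[OF assms])
        (simp add: g_simps conformal_basis[OF assms] g_normal[OF assms] algebra_simps)
    moreover have "det (vector [unit_normal g f z, D f z v, w] :: real^3^3)
        = (Re v * b - Im v * a) / \<mu> z * ?d"
    proof -
      have "\<mu> z * det (vector [unit_normal g f z, D f z v, w] :: real^3^3)
          = det (vector [normal z, D f z v, w] :: real^3^3)"
        unfolding det_vector_3 unit_normal_eq[OF assms] using \<mu>_pos[OF assms] by (simp add: field_simps)
      also have "\<dots> = (Re v * b - Im v * a) * det (vector [normal z, D f z 1, D f z \<i>] :: real^3^3)"
        unfolding w Df_expand[OF assms, of v] det_vector_3 by (simp add: algebra_simps)
      also have "det (vector [normal z, D f z 1, D f z \<i>] :: real^3^3) = ?d"
        unfolding det_vector_3 normal_def by (simp add: e3_def axis_def algebra_simps)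
      finally show ?thesis using \<mu>_pos[OF assms] by (simp add: field_simps)
    qed
    moreover have "?K * ((Re v * b - Im v * a) / \<mu> z * ?d) = (Re v * b - Im v * a) / \<mu> z * (?K * ?d)"
      by (rule mult.left_commute)
    moreover have "\<dots> = \<epsilon> z * (r z * (Re v * b - Im v * a))"
      unfolding det_metric_matrix(1)[OF assms] using \<mu>_pos[OF assms] by simp
    ultimately show ?thesis by presburger
  qed
  show ?thesis unfolding rot_J_def cross_product_def
    by (rule the_equality) (use * g_cancel[OF assms] in auto)
qed

lemma inv_Df: "z \<in> S \<Longrightarrow> inv (D f z) (D f z v) = v"
proof (rule inv_f_f)
  assume z: "z \<in> S"
  have "D f z x = 0 \<Longrightarrow> x = 0" for x
    using conformal[OF z, of x x] r_pos[OF z] by (simp add: g_simps)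
  then show "inj (D f z)"
    using linear_injective_0[OF Df_linear[OF z]] by blast
qed

section \<open>The second fundamental form in terms of h and r\<close>

lemma has_derivative_Df: "z \<in> S \<Longrightarrow> ((\<lambda>z. D f z v) has_derivative D (\<lambda>z. D f z v) z) (at z)"
  using Df_differentiable by (simp add: frechet_derivative_works)

lemma has_derivative_f: "z \<in> S \<Longrightarrow> (f has_derivative D f z) (at z)"
  using f_differentiable by (simp add: frechet_derivative_works)

lemma cov_deriv_eq:
  "cov_deriv g f z v w = D (\<lambda>z'. D f z' w) z v + connection (f z) (D f z v) (D f z w)"
  by (simp add: cov_deriv_def connection_def mult.assoc)

lemma second_derivative_sym:
  "z \<in> S \<Longrightarrow> D (\<lambda>z'. D f z' w) z v = D (\<lambda>z'. D f z' v) z w"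
  using mixed_derivatives_commute[OF open_S _ f_differentiable] Df_differentiable by blast

lemma has_derivative_h:
  assumes "z \<in> S"
  shows "(h w has_derivative (\<lambda>v. dg (f z) (D f z v) (D f z w) e3 + g (f z) (D (\<lambda>z'. D f z' w) z v) e3)) (at z)"
  using has_derivative_g[of f z, OF f_in_P[OF assms] has_derivative_f[OF assms]
      has_derivative_Df[OF assms, of w] has_derivative_const[of e3]]
  by (simp add: h_def[abs_def] g_simps)

lemma h_differentiable: "z \<in> S \<Longrightarrow> h w differentiable (at z)"
  using has_derivative_h by (auto simp: differentiable_def)

lemma D_h:
  "z \<in> S \<Longrightarrow> D (h w) z v = dg (f z) (D f z v) (D f z w) e3 + g (f z) (D (\<lambda>z'. D f z' w) z v) e3"
  by (simp add: frechet_derivative_eqI[OF has_derivative_h])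

lemma has_derivative_induced:
  assumes "z \<in> S"
  shows "((\<lambda>z. r z * (w \<bullet> u)) has_derivative (\<lambda>v. dg (f z) (D f z v) (D f z w) (D f z u)
    + g (f z) (D (\<lambda>z'. D f z' w) z v) (D f z u) + g (f z) (D f z w) (D (\<lambda>z'. D f z' u) z v))) (at z)"
  using has_derivative_g[of f z, OF f_in_P[OF assms] has_derivative_f[OF assms]
      has_derivative_Df[OF assms, of w] has_derivative_Df[OF assms, of u]] open_S assms
  by (rule has_derivative_transform_within_open) (simp add: conformal)

lemma r_differentiable: "z \<in> S \<Longrightarrow> r differentiable (at z)"
  using has_derivative_induced[of z 1 1] by (auto simp: differentiable_def)

lemma D_r:
  assumes "z \<in> S"
  shows "D r z v * (w \<bullet> u) = dg (f z) (D f z v) (D f z w) (D f z u)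
    + g (f z) (D (\<lambda>z'. D f z' w) z v) (D f z u) + g (f z) (D f z w) (D (\<lambda>z'. D f z' u) z v)"
proof -
  have "((\<lambda>z. r z * (w \<bullet> u)) has_derivative (\<lambda>v. D r z v * (w \<bullet> u))) (at z)"
    using r_differentiable[OF assms] by (intro has_derivative_mult_left) (simp add: frechet_derivative_works)
  from has_derivative_unique[OF this has_derivative_induced[OF assms]] show ?thesis by meson
qed

text \<open>This is where the Killing property enters: the Koszul term differentiating the metric
  along \<open>e3\<close> vanishes, and the two remaining ones, together with the symmetric second
  derivative of f, make up derivatives of h.\<close>

lemma cov_deriv_e3:
  assumes "z \<in> S"
  shows "g (f z) (cov_deriv g f z v w) e3 = (D (h w) z v + D (h v) z w) / 2"
proof -
  have "2 * g (f z) (cov_deriv g f z v w) e3 = 2 * g (f z) (D (\<lambda>z'. D f z' w) z v) e3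
      + 2 * g (f z) (connection (f z) (D f z v) (D f z w)) e3"
    by (simp add: cov_deriv_eq g_simps)
  also have "\<dots> = D (h w) z v + D (h v) z w"
    using second_derivative_sym[OF assms, of v w]
    by (simp add: connection_koszul f_in_P assms dg_e3 D_h)
  finally show ?thesis by simp
qed

text \<open>The tangential part of the ambient derivative is the Levi-Civita connection of r |dz|^2:
  second derivatives of f complete the three ambient Koszul terms to derivatives of the induced
  metric.\<close>

lemma cov_deriv_tangent:
  assumes "z \<in> S"
  shows "g (f z) (cov_deriv g f z v w) (D f z u) =
    (D r z v * (w \<bullet> u) + D r z w * (v \<bullet> u) - D r z u * (v \<bullet> w)) / 2"
proof -
  have "2 * g (f z) (cov_deriv g f z v w) (D f z u) = 2 * g (f z) (D (\<lambda>z'. D f z' w) z v) (D f z u)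
      + 2 * g (f z) (connection (f z) (D f z v) (D f z w)) (D f z u)"
    by (simp add: cov_deriv_eq g_simps)
  also have "\<dots> = D r z v * (w \<bullet> u) + D r z w * (v \<bullet> u) - D r z u * (v \<bullet> w)"
    unfolding connection_koszul[OF f_in_P[OF assms]] D_r[OF assms]
    using second_derivative_sym[OF assms, of v w] second_derivative_sym[OF assms, of u w]
      second_derivative_sym[OF assms, of u v]
    by (simp add: g_sym[of _ "D f z _" "D _ z _"] )
  finally show ?thesis by simp
qed

text \<open>Writing the normal as \<open>e3\<close> minus its tangential part reduces the claim to
  \<open>cov_deriv_e3\<close> and \<open>cov_deriv_tangent\<close>; second derivatives of f then
  enter only through h and r.\<close>

lemma second_ff_eq:
  assumes "z \<in> S"
  shows "second_ff g f z (D f z v) (D f z w) =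
    ((D (h w) z v + D (h v) z w)
     - h 1 z / r z * (D r z v * Re w + D r z w * Re v - D r z 1 * (v \<bullet> w))
     - h \<i> z / r z * (D r z v * Im w + D r z w * Im v - D r z \<i> * (v \<bullet> w))) / (2 * \<mu> z)"
proof -
  have "second_ff g f z (D f z v) (D f z w) = g (f z) (cov_deriv g f z v w) (normal z) / \<mu> z"
    by (simp add: second_ff_def inv_Df assms unit_normal_eq g_simps)
  also have "g (f z) (cov_deriv g f z v w) (normal z) = g (f z) (cov_deriv g f z v w) e3
      - h 1 z / r z * g (f z) (cov_deriv g f z v w) (D f z 1)
      - h \<i> z / r z * g (f z) (cov_deriv g f z v w) (D f z \<i>)"
    by (simp add: normal_def g_simps)
  also have "\<dots> =
    ((D (h w) z v + D (h v) z w)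
     - h 1 z / r z * (D r z v * Re w + D r z w * Re v - D r z 1 * (v \<bullet> w))
     - h \<i> z / r z * (D r z v * Im w + D r z w * Im v - D r z \<i> * (v \<bullet> w))) / 2"
    by (simp only: cov_deriv_e3[OF assms] cov_deriv_tangent[OF assms] times_divide_eq_right
        diff_divide_distrib[symmetric] complex_inner_1_right complex_inner_i_right)
  finally show ?thesis by simp
qed

lemma D_h_expand:
  assumes "z \<in> S"
  shows "D (h w) z v = Re w * (Re v * D (h 1) z 1 + Im v * D (h 1) z \<i>)
    + Im w * (Re v * D (h \<i>) z 1 + Im v * D (h \<i>) z \<i>)"
proof -
  have "((\<lambda>z. Re w * h 1 z + Im w * h \<i> z) has_derivative (\<lambda>v. Re w * D (h 1) z v + Im w * D (h \<i>) z v)) (at z)"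
    using h_differentiable[OF assms]
    by (intro has_derivative_add has_derivative_mult_right) (simp_all add: frechet_derivative_works)
  then have "(h w has_derivative (\<lambda>v. Re w * D (h 1) z v + Im w * D (h \<i>) z v)) (at z)"
    using open_S assms by (rule has_derivative_transform_within_open) (simp add: h_expand[of _ w])
  then have "D (h w) z v = Re w * D (h 1) z v + Im w * D (h \<i>) z v"
    by (simp add: frechet_derivative_eqI)
  moreover have "D (h u) z v = Re v * D (h u) z 1 + Im v * D (h u) z \<i>" for u
  proof -
    have l: "linear (D (h u) z)" using h_differentiable[OF assms] by (rule linear_frechet_derivative)
    have "v = Re v *\<^sub>R 1 + Im v *\<^sub>R \<i>" by (simp add: complex_eq_iff)
    then show ?thesis using linear_add[OF l] linear_cmul[OF l] by (metis real_scaleR_def)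
  qed
  note this[of 1] this[of \<i>]
  ultimately show ?thesis by simp
qed

lemma D_r_expand:
  assumes "z \<in> S" shows "D r z v = Re v * D r z 1 + Im v * D r z \<i>"
proof -
  have l: "linear (D r z)" using r_differentiable[OF assms] by (rule linear_frechet_derivative)
  have "v = Re v *\<^sub>R 1 + Im v *\<^sub>R \<i>" by (simp add: complex_eq_iff)
  then show ?thesis using linear_add[OF l] linear_cmul[OF l] by (metis real_scaleR_def)
qed

section \<open>The Hopf coefficient and the quadratic differential\<close>

text \<open>The complexified second fundamental form evaluated twice on X - i J X for X =
  \<open>D f z 1\<close>, that is, S11 - S22 - 2 i \<epsilon> S12 with Sjk its values on the
  coordinate vectors.\<close>

definition hopf :: "complex \<Rightarrow> complex" where
  "hopf z = Complex
     (D (h 1) z 1 - D (h \<i>) z \<i> - (D r z 1 * h 1 z - D r z \<i> * h \<i> z) / r z)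
     (- \<epsilon> z * (D (h 1) z \<i> + D (h \<i>) z 1 - (D r z \<i> * h 1 z + D r z 1 * h \<i> z) / r z)) / \<mu> z"

text \<open>The vectors X - i J X form a complex line: passing from direction 1 to direction v
  multiplies them by v if \<epsilon> = 1 and by the conjugate of v if \<epsilon> = -1. So at each
  point a single complex number determines the differential.\<close>

lemma pullback_quad_diff_eq:
  assumes "z \<in> S"
  shows "pullback_quad_diff g a b f z v w =
    Complex (Re v) (\<epsilon> z * Im v) * Complex (Re w) (\<epsilon> z * Im w) *
    (a * hopf z + b * (Complex (h 1 z) (- \<epsilon> z * h \<i> z))\<^sup>2)"
proof -
  have J: "- rot_J g f z (D f z u) = D f z (of_real (- \<epsilon> z) * \<i> * u)" for u
    using linear_cmul[OF Df_linear[OF assms], of "- \<epsilon> z" "\<i> * u"]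
    by (simp add: rot_J_eq[OF assms] scaleR_conv_of_real mult.assoc)
  have e: "\<epsilon> z * \<epsilon> z = 1" by (rule det_metric_matrix(2)[OF assms])
  have hc: "cx_linear (\<lambda>w. g (f z) w e3) (D f z u, - rot_J g f z (D f z u))
      = Complex (Re u) (\<epsilon> z * Im u) * Complex (h 1 z) (- \<epsilon> z * h \<i> z)" for u
  proof -
    have "cx_linear (\<lambda>w. g (f z) w e3) (D f z u, - rot_J g f z (D f z u))
      = Complex (h u z) (h (of_real (- \<epsilon> z) * \<i> * u) z)"
      unfolding J by (simp add: cx_linear_def h_def)
    also have "\<dots> = Complex (Re u) (\<epsilon> z * Im u) * Complex (h 1 z) (- \<epsilon> z * h \<i> z)"
      unfolding h_expand[OF assms, of u] h_expand[OF assms, of "of_real (- \<epsilon> z) * \<i> * u"]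
      using e by (simp add: complex_eq_iff algebra_simps)
    finally show ?thesis .
  qed
  have sc: "cx_bilinear (second_ff g f z) (D f z v, - rot_J g f z (D f z v)) (D f z w, - rot_J g f z (D f z w))
     = Complex (Re v) (\<epsilon> z * Im v) * Complex (Re w) (\<epsilon> z * Im w) * hopf z"
  proof -
    define T where "T v w = (D (h w) z v + D (h v) z w)
     - h 1 z / r z * (D r z v * Re w + D r z w * Re v - D r z 1 * (v \<bullet> w))
     - h \<i> z / r z * (D r z v * Im w + D r z w * Im v - D r z \<i> * (v \<bullet> w))" for v w
    have T: "second_ff g f z (D f z v) (D f z w) = T v w / (2 * \<mu> z)" for v w
      by (simp add: second_ff_eq[OF assms] T_def)
    define p q where "p = h 1 z / r z" and "q = h \<i> z / r z"
    have hopf: "hopf z = Complex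
        (D (h 1) z 1 - D (h \<i>) z \<i> - (D r z 1 * p - D r z \<i> * q))
        (- \<epsilon> z * (D (h 1) z \<i> + D (h \<i>) z 1 - (D r z \<i> * p + D r z 1 * q))) / \<mu> z"
      by (simp add: hopf_def p_def q_def add_divide_distrib diff_divide_distrib)
    have T': "T v w = (D (h w) z v + D (h v) z w)
     - p * (D r z v * Re w + D r z w * Re v - D r z 1 * (v \<bullet> w))
     - q * (D r z v * Im w + D r z w * Im v - D r z \<i> * (v \<bullet> w))" for v w
      by (simp add: T_def p_def q_def)
    have "Complex (T v w - T (of_real (- \<epsilon> z) * \<i> * v) (of_real (- \<epsilon> z) * \<i> * w))
        (T v (of_real (- \<epsilon> z) * \<i> * w) + T (of_real (- \<epsilon> z) * \<i> * v) w) =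
      2 * (Complex (Re v) (\<epsilon> z * Im v) * Complex (Re w) (\<epsilon> z * Im w)) *
      Complex
        (D (h 1) z 1 - D (h \<i>) z \<i> - (D r z 1 * p - D r z \<i> * q))
        (- \<epsilon> z * (D (h 1) z \<i> + D (h \<i>) z 1 - (D r z \<i> * p + D r z 1 * q)))" (is "?L = ?R")
    proof -
      \<comment> \<open>The coefficients of the bilinear form T in the real basis 1, i. With these
        the claim is a polynomial identity, checked separately for the two values of
        \<epsilon>.\<close>
      define t11 t12 t22 where "t11 = 2 * D (h 1) z 1 - p * D r z 1 + q * D r z \<i>"
        and "t12 = D (h 1) z \<i> + D (h \<i>) z 1 - p * D r z \<i> - q * D r z 1"
        and "t22 = 2 * D (h \<i>) z \<i> + p * D r z 1 - q * D r z \<i>"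
      have *: "T v w = t11 * Re v * Re w + t12 * (Re v * Im w + Im v * Re w) + t22 * Im v * Im w" for v w
        unfolding T' D_h_expand[OF assms, of v] D_h_expand[OF assms, of w]
          D_r_expand[OF assms, of v] D_r_expand[OF assms, of w] t11_def t12_def t22_def
        by (simp add: inner_complex_def algebra_simps)
      have "?R = Complex (Re v) (\<epsilon> z * Im v) * Complex (Re w) (\<epsilon> z * Im w) *
          Complex (t11 - t22) (- 2 * \<epsilon> z * t12)"
        by (simp add: t11_def t12_def t22_def complex_eq_iff algebra_simps)
      moreover have "\<epsilon> z = 1 \<or> \<epsilon> z = - 1" using e by (simp add: square_eq_1_iff)
      ultimately show ?thesis
        unfolding * by (auto simp: complex_eq_iff algebra_simps)
    qed
    moreover have "cx_bilinear (second_ff g f z) (D f z v, - rot_J g f z (D f z v)) (D f z w, - rot_J g f z (D f z w))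
      = Complex (T v w - T (of_real (- \<epsilon> z) * \<i> * v) (of_real (- \<epsilon> z) * \<i> * w))
        (T v (of_real (- \<epsilon> z) * \<i> * w) + T (of_real (- \<epsilon> z) * \<i> * v) w) / (2 * \<mu> z)"
      unfolding J by (simp add: cx_bilinear_def T complex_eq_iff diff_divide_distrib add_divide_distrib)
    ultimately show ?thesis unfolding hopf by simp
  qed
  show ?thesis
    unfolding pullback_quad_diff_def quad_diff_def Let_def sc hc
    by (simp add: algebra_simps power2_eq_square)
qed

end

section \<open>The model metrics\<close>

text \<open>The connection form of the Killing submersion: its kernel is the horizontal plane, and
  it takes the value 1 on \<open>e3\<close>.\<close>

definition kform :: "real \<Rightarrow> real \<Rightarrow> real^3 \<Rightarrow> real^3 \<Rightarrow> real" where
  "kform \<kappa> t p w = w$3 + t * conf_factor \<kappa> (p$1) (p$2) * (p$2 * w$1 - p$1 * w$2)"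

definition kmetric :: "real \<Rightarrow> real \<Rightarrow> real \<Rightarrow> metric" where
  "kmetric \<kappa> s t p u v = (conf_factor \<kappa> (p$1) (p$2))\<^sup>2 * (u$1 * v$1 + u$2 * v$2)
     + s * kform \<kappa> t p u * kform \<kappa> t p v"

lemma E_metric_eq: "E_metric \<kappa> \<tau> = kmetric \<kappa> 1 \<tau>"
  by (intro ext) (simp add: E_metric_def kmetric_def kform_def Let_def)

lemma L_metric_eq: "L_metric \<kappa> H = kmetric \<kappa> (- 1) (- H)"
  by (intro ext) (simp add: L_metric_def kmetric_def kform_def Let_def algebra_simps)

definition model_space :: "real \<Rightarrow> (real^3) set" where
  "model_space \<kappa> = {p. base_coords p \<in> Omega \<kappa>}"

lemma model_space_iff: "p \<in> model_space \<kappa> \<longleftrightarrow> 1 + \<kappa> / 4 * ((p$1)\<^sup>2 + (p$2)\<^sup>2) > 0"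
  by (simp add: model_space_def base_coords_def Omega_def)

lemma conf_factor_pos: "p \<in> model_space \<kappa> \<Longrightarrow> conf_factor \<kappa> (p$1) (p$2) > 0"
  by (simp add: model_space_iff conf_factor_def)

lemma has_derivative_nth: "((\<lambda>q. q $ i) has_derivative (\<lambda>x. x $ i)) (at p)"
  by (rule bounded_linear.has_derivative[OF bounded_linear_vec_nth has_derivative_ident])

definition d_conf_factor :: "real \<Rightarrow> real^3 \<Rightarrow> real^3 \<Rightarrow> real" where
  "d_conf_factor \<kappa> p x = - \<kappa> / 2 * (conf_factor \<kappa> (p$1) (p$2))\<^sup>2 * (p$1 * x$1 + p$2 * x$2)"

lemma has_derivative_conf_factor:
  assumes "p \<in> model_space \<kappa>"
  shows "((\<lambda>q. conf_factor \<kappa> (q$1) (q$2)) has_derivative d_conf_factor \<kappa> p) (at p)"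
proof -
  have n: "1 + \<kappa> / 4 * ((p$1)\<^sup>2 + (p$2)\<^sup>2) \<noteq> 0" using assms by (simp add: model_space_iff)
  have 1: "((\<lambda>q. 1 + \<kappa> / 4 * ((q$1)\<^sup>2 + (q$2)\<^sup>2)) has_derivative
      (\<lambda>x. \<kappa> / 4 * (2 * (p$1 * x$1) + 2 * (p$2 * x$2)))) (at p)"
    by (auto intro!: derivative_eq_intros has_derivative_nth simp: mult_ac)
  have l: "conf_factor \<kappa> x y = inverse (1 + \<kappa> / 4 * (x\<^sup>2 + y\<^sup>2))" for x y
    by (simp add: conf_factor_def inverse_eq_divide)
  have "((\<lambda>q. conf_factor \<kappa> (q$1) (q$2)) has_derivative
      (\<lambda>x. - (conf_factor \<kappa> (p$1) (p$2) * (\<kappa> / 4 * (2 * (p$1 * x$1) + 2 * (p$2 * x$2)))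
        * conf_factor \<kappa> (p$1) (p$2)))) (at p)"
    unfolding l by (rule Deriv.has_derivative_inverse[OF n 1])
  then show ?thesis
    by (rule has_derivative_eq_rhs) (simp add: fun_eq_iff d_conf_factor_def power2_eq_square algebra_simps)
qed

definition d_kform :: "real \<Rightarrow> real \<Rightarrow> real^3 \<Rightarrow> real^3 \<Rightarrow> real^3 \<Rightarrow> real" where
  "d_kform \<kappa> t p x u = t * (d_conf_factor \<kappa> p x * (p$2 * u$1 - p$1 * u$2)
     + conf_factor \<kappa> (p$1) (p$2) * (x$2 * u$1 - x$1 * u$2))"

lemma has_derivative_kform:
  assumes "p \<in> model_space \<kappa>"
  shows "((\<lambda>q. kform \<kappa> t q u) has_derivative (\<lambda>x. d_kform \<kappa> t p x u)) (at p)"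
  unfolding kform_def d_kform_def
  by (rule has_derivative_eq_rhs,
      (rule has_derivative_conf_factor[OF assms] has_derivative_nth derivative_intros)+)
    (simp add: algebra_simps)

lemma has_derivative_kmetric:
  assumes "p \<in> model_space \<kappa>"
  shows "((\<lambda>q. kmetric \<kappa> s t q u v) has_derivative
    (\<lambda>x. 2 * conf_factor \<kappa> (p$1) (p$2) * d_conf_factor \<kappa> p x * (u$1 * v$1 + u$2 * v$2)
      + s * (d_kform \<kappa> t p x u * kform \<kappa> t p v + kform \<kappa> t p u * d_kform \<kappa> t p x v))) (at p)"
  unfolding kmetric_def power2_eq_square
  by (rule has_derivative_eq_rhs,
      (rule has_derivative_conf_factor[OF assms] has_derivative_kform[OF assms] derivative_intros)+)
    (simp add: algebra_simps)

lemma axis_1_nth [simp]: "(axis i 1 :: real^3) $ j = (if i = j then 1 else 0)"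
  by (auto simp: axis_def)

lemma kform_e3 [simp]: "kform \<kappa> t p e3 = 1"
  by (simp add: kform_def e3_def)

lemma kmetric_e3 [simp]: "kmetric \<kappa> s t p u e3 = s * kform \<kappa> t p u"
  by (simp add: kmetric_def) (simp add: e3_def)

lemma det_kmetric: "det (metric_matrix (kmetric \<kappa> s t) p) = s * (conf_factor \<kappa> (p$1) (p$2))^4"
  unfolding det_3 metric_matrix_def kmetric_def kform_def by simp algebra

lemma bilinear_kmetric: "bilinear (kmetric \<kappa> s t p)"
  unfolding bilinear_def
  by (intro conjI allI linearI) (simp_all add: kmetric_def kform_def algebra_simps)

lemma killing_metric_kmetric:
  assumes "s * s = 1"
  shows "killing_metric (kmetric \<kappa> s t) (model_space \<kappa>) s"
proof
  fix p u v
  show "kmetric \<kappa> s t p u v = kmetric \<kappa> s t p v u" by (simp add: kmetric_def algebra_simps)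
  assume p: "p \<in> model_space \<kappa>"
  show "det (metric_matrix (kmetric \<kappa> s t) p) \<noteq> 0"
    using assms conf_factor_pos[OF p] by (auto simp: det_kmetric)
  show "(\<lambda>q. kmetric \<kappa> s t q u v) differentiable (at p)"
    unfolding differentiable_def using has_derivative_kmetric[OF p] by blast
  show "D (\<lambda>q. kmetric \<kappa> s t q u v) p e3 = 0"
    unfolding frechet_derivative_eqI[OF has_derivative_kmetric[OF p]]
    by (simp add: d_kform_def d_conf_factor_def e3_def)
qed (use assms bilinear_kmetric in auto)

locale model_surface = conformal_surface "kmetric \<kappa> s t" "model_space \<kappa>" s S f r
  for \<kappa> s t S f r
begin

definition jac :: "complex \<Rightarrow> real" where
  "jac z = D f z 1 $ 1 * D f z \<i> $ 2 - D f z 1 $ 2 * D f z \<i> $ 1"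

abbreviation l :: "complex \<Rightarrow> real" where
  "l z \<equiv> conf_factor \<kappa> (f z $ 1) (f z $ 2)"

lemma \<epsilon>_jac: "\<epsilon> z = sgn (jac z)"
  by (simp add: base_orientation_def jac_def)

text \<open>The volume density of the metric is the squared conformal factor, so
  \<open>det_metric_matrix\<close> says that the base area pulls back to \<epsilon> \<mu> times the
  area of the surface.\<close>

lemma l_jac:
  assumes "z \<in> S" shows "(l z)\<^sup>2 * jac z = \<epsilon> z * \<mu> z * r z"
proof -
  have "sqrt \<bar>det (metric_matrix (kmetric \<kappa> s t) (f z))\<bar> = (l z)\<^sup>2"
    by (rule real_sqrt_unique) (simp_all add: det_kmetric abs_mult s_abs power_mult[symmetric])
  then show ?thesis using det_metric_matrix(1)[OF assms] by (simp add: jac_def)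
qed

lemma h_kform: "h v z = s * kform \<kappa> t (f z) (D f z v)"
  by (simp add: h_def)

text \<open>The ambient metric is the base metric plus s times the square of the connection form,
  and h is s times this form; the factors s combine by s * s = 1.\<close>

lemma base_metric:
  assumes "z \<in> S"
  shows "(l z)\<^sup>2 * (D f z v $ 1 * D f z w $ 1 + D f z v $ 2 * D f z w $ 2)
    = r z * (v \<bullet> w) - s * h v z * h w z"
proof -
  have "s * h v z * h w z = s * s * (s * (kform \<kappa> t (f z) (D f z v) * kform \<kappa> t (f z) (D f z w)))"
    by (simp add: h_kform mult_ac)
  then have "s * h v z * h w z = s * kform \<kappa> t (f z) (D f z v) * kform \<kappa> t (f z) (D f z w)"
    by (simp add: s_square)
  then show ?thesis using conformal[OF assms, of v w] unfolding kmetric_def by linarith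
qed

lemma dg_kmetric_e3: "p \<in> model_space \<kappa> \<Longrightarrow> dg p x u e3 = s * d_kform \<kappa> t p x u"
proof -
  assume p: "p \<in> model_space \<kappa>"
  have "d_kform \<kappa> t p x e3 = 0" by (simp add: d_kform_def e3_def)
  then show ?thesis
    unfolding dg_def frechet_derivative_eqI[OF has_derivative_kmetric[OF p]]
    by (simp add: e3_def[THEN arg_cong[of _ _ "\<lambda>w. w $ _"]])
qed

text \<open>The exterior derivative of the connection form is - 2 t times the area form of the base:
  t is the bundle curvature. The derivative of the conformal factor is absorbed by its defining
  equation, the fact labelled 1.\<close>

lemma d_kform_antisym:
  assumes "p \<in> model_space \<kappa>"
  shows "d_kform \<kappa> t p x u - d_kform \<kappa> t p u x
    = - 2 * t * (conf_factor \<kappa> (p$1) (p$2))\<^sup>2 * (x$1 * u$2 - x$2 * u$1)"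
proof -
  let ?l = "conf_factor \<kappa> (p$1) (p$2)"
  have 1: "?l * (1 + \<kappa> / 4 * ((p$1)\<^sup>2 + (p$2)\<^sup>2)) = 1"
    using assms by (simp add: conf_factor_def model_space_iff)
  have d: "d_conf_factor \<kappa> p x = - 2 * ((\<kappa> / 4) * (?l * ?l * (p$1 * x$1 + p$2 * x$2)))" for x
    by (simp add: d_conf_factor_def power2_eq_square)
  have "d_kform \<kappa> t p x u - d_kform \<kappa> t p u x =
    t * (x$2 * u$1 - x$1 * u$2) * (2 * ?l - 2 * ?l\<^sup>2 * (\<kappa> / 4 * ((p$1)\<^sup>2 + (p$2)\<^sup>2)))"
    unfolding d_kform_def d power2_eq_square by algebra
  also have "2 * ?l - 2 * ?l\<^sup>2 * (\<kappa> / 4 * ((p$1)\<^sup>2 + (p$2)\<^sup>2)) = 2 * ?l\<^sup>2"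
    using 1 by algebra
  finally show ?thesis by (simp add: algebra_simps)
qed

text \<open>The second derivatives of f are symmetric and cancel. What remains is s times the
  pulled-back exterior derivative of the connection form, and \<open>l_jac\<close> expresses the
  base area through \<mu> and r.\<close>

lemma curl_h:
  assumes "z \<in> S"
  shows "D (h \<i>) z 1 - D (h 1) z \<i> = - 2 * s * t * \<epsilon> z * \<mu> z * r z"
proof -
  have "D (h \<i>) z 1 - D (h 1) z \<i> = s * (d_kform \<kappa> t (f z) (D f z 1) (D f z \<i>) - d_kform \<kappa> t (f z) (D f z \<i>) (D f z 1))"
    using second_derivative_sym[OF assms, of 1 \<i>]
    by (simp add: D_h[OF assms] dg_kmetric_e3 f_in_P[OF assms] right_diff_distrib)
  also have "\<dots> = - 2 * s * t * ((l z)\<^sup>2 * jac z)"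
    unfolding d_kform_antisym[OF f_in_P[OF assms]] jac_def by simp
  finally show ?thesis unfolding l_jac[OF assms] by simp
qed

end

text \<open>With $X_j, Y_j$ the components of the base map in the orthonormal frame, the twin relations become
  the statement that the two one-forms differ by a rotation.\<close>
lemma twin_algebra:
  fixes X1 X2 Y1 Y2 \<alpha> \<beta> \<alpha>' \<beta>' h1' h2' r' :: real
  defines "\<omega>' \<equiv> sqrt (1 - \<alpha>'\<^sup>2 - \<beta>'\<^sup>2)" and "d \<equiv> X1 * Y2 - Y1 * X2"
  assumes "r' > 0"
    and 11: "X1 * X1 + Y1 * Y1 = r' + h1' * h1'" and 22: "X2 * X2 + Y2 * Y2 = r' + h2' * h2'"
    and 12: "X1 * X2 + Y1 * Y2 = h1' * h2'"
    and h1': "h1' = - (\<alpha>' * X1 + \<beta>' * Y1)" and h2': "h2' = - (\<alpha>' * X2 + \<beta>' * Y2)"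
    and \<alpha>: "\<alpha> = \<beta>' / \<omega>'" and \<beta>: "\<beta> = - \<alpha>' / \<omega>'"
  shows "\<alpha> * X1 + \<beta> * Y1 = - sgn d * h2'" "\<alpha> * X2 + \<beta> * Y2 = sgn d * h1'"
proof -
  \<comment> \<open>Gram determinant of the base vectors (X1, Y1) and (X2, Y2), whose Gram matrix is
    r' times the identity plus the rank-one matrix of products of h1' and h2'.\<close>
  have d2: "d\<^sup>2 = r' * (r' + h1' * h1' + h2' * h2')"
  proof -
    have "d\<^sup>2 = (X1 * X1 + Y1 * Y1) * (X2 * X2 + Y2 * Y2) - (X1 * X2 + Y1 * Y2) * (X1 * X2 + Y1 * Y2)"
      by (simp add: d_def power2_eq_square algebra_simps)
    then show ?thesis unfolding 11 22 12 by (simp add: algebra_simps)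
  qed
  moreover have "\<dots> > 0" using \<open>r' > 0\<close> by (intro mult_pos_pos) (auto simp: add_pos_nonneg)
  ultimately have d: "d \<noteq> 0" by auto
  \<comment> \<open>Cramer's rule for \<alpha>' and \<beta>' in the two equations for h1' and
    h2'.\<close>
  have a': "d * \<alpha>' = - (h1' * Y2 - h2' * Y1)" and b': "d * \<beta>' = h1' * X2 - h2' * X1"
    unfolding h1' h2' d_def by (simp_all add: algebra_simps)
  \<comment> \<open>Leads to the square of r' / d; taking the root in \<omega>' leaves the modulus
    of d, and this is the origin of \<open>sgn d\<close> in the conclusion.\<close>
  have "d\<^sup>2 * (1 - \<alpha>'\<^sup>2 - \<beta>'\<^sup>2) = d\<^sup>2 - (d * \<alpha>')\<^sup>2 - (d * \<beta>')\<^sup>2"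
    by (simp add: algebra_simps power_mult_distrib)
  also have "\<dots> = d\<^sup>2 - (h1' * h1' * (X2 * X2 + Y2 * Y2) + h2' * h2' * (X1 * X1 + Y1 * Y1)
      - 2 * h1' * h2' * (X1 * X2 + Y1 * Y2))"
    unfolding a' b' by (simp add: power2_eq_square algebra_simps)
  also have "\<dots> = r'\<^sup>2" unfolding d2 11 22 12 by (simp add: power2_eq_square algebra_simps)
  finally have "1 - \<alpha>'\<^sup>2 - \<beta>'\<^sup>2 = (r' / d)\<^sup>2" using d by (simp add: field_simps)
  then have \<omega>: "\<omega>' = r' / \<bar>d\<bar>" using \<open>r' > 0\<close> by (simp add: \<omega>'_def real_sqrt_abs)
  have "d * (\<beta>' * X1 - \<alpha>' * Y1) = h1' * (X1 * X2 + Y1 * Y2) - h2' * (X1 * X1 + Y1 * Y1)"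
    using a' b' by algebra
  then have 1: "d * (\<beta>' * X1 - \<alpha>' * Y1) = - h2' * r'" unfolding 11 12 by (simp add: algebra_simps)
  have "d * (\<beta>' * X2 - \<alpha>' * Y2) = h1' * (X2 * X2 + Y2 * Y2) - h2' * (X1 * X2 + Y1 * Y2)"
    using a' b' by algebra
  then have 2: "d * (\<beta>' * X2 - \<alpha>' * Y2) = h1' * r'" unfolding 22 12 by (simp add: algebra_simps)
  have s: "\<bar>d\<bar> = sgn d * d" by (simp add: abs_sgn mult.commute)
  have "\<alpha> * X1 + \<beta> * Y1 = (\<beta>' * X1 - \<alpha>' * Y1) / \<omega>'" by (simp add: \<alpha> \<beta> diff_divide_distrib)
  also have "\<dots> = sgn d * (d * (\<beta>' * X1 - \<alpha>' * Y1)) / r'" by (simp add: \<omega> s)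
  finally show "\<alpha> * X1 + \<beta> * Y1 = - sgn d * h2'" unfolding 1 using \<open>r' > 0\<close> by simp
  have "\<alpha> * X2 + \<beta> * Y2 = (\<beta>' * X2 - \<alpha>' * Y2) / \<omega>'" by (simp add: \<alpha> \<beta> diff_divide_distrib)
  also have "\<dots> = sgn d * (d * (\<beta>' * X2 - \<alpha>' * Y2)) / r'" by (simp add: \<omega> s)
  finally show "\<alpha> * X2 + \<beta> * Y2 = sgn d * h1'" unfolding 2 using \<open>r' > 0\<close> by simp
qed

section \<open>Surfaces satisfying the twin relations\<close>

lemma D_transform:
  assumes "f differentiable (at x)" "open T" "x \<in> T" "\<And>y. y \<in> T \<Longrightarrow> f y = g y"
  shows "D g x = D f x"
  using frechet_derivative_transform_within_open[OF assms] by simp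

text \<open>The functions h and r agree on an open set, hence so do their derivatives, and besides
  these \<open>hopf\<close> contains only the sign \<epsilon>.\<close>

lemma (in conformal_surface) hopf_cong:
  assumes "conformal_surface g P s S f2 r2" "z \<in> S"
    and hh: "\<And>v y. y \<in> S \<Longrightarrow> g (f2 y) (D f2 y v) e3 = g (f y) (D f y v) e3"
    and rr: "\<And>y. y \<in> S \<Longrightarrow> r2 y = r y"
    and ee: "base_orientation f2 z = \<epsilon> z"
  shows "conformal_surface.hopf g s f2 r2 z = hopf z"
proof -
  interpret B: conformal_surface g P s S f2 r2 by fact
  have h: "B.h v y = h v y" if "y \<in> S" for v y using hh[OF that] by (simp add: B.h_def h_def)
  have Dh: "D (B.h v) z = D (h v) z" for v
    using D_transform[OF h_differentiable[OF assms(2)] open_S assms(2)] h by metis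
  have Dr: "D r2 z = D r z"
    using D_transform[OF r_differentiable[OF assms(2)] open_S assms(2)] rr by metis
  show ?thesis
    by (simp add: B.hopf_def hopf_def B.\<mu>_def \<mu>_def h assms(2) Dh Dr rr ee)
qed

lemma (in model_surface) restrict:
  assumes "open T" "T \<subseteq> S" shows "model_surface \<kappa> s t T f r"
  by unfold_locales
    (use assms f_differentiable Df_differentiable f_in_P conformal r_pos transversal in auto)

text \<open>The Jacobian is continuous and nowhere zero. Local constancy of the sign is what allows
  differentiating relations between one-forms that contain \<epsilon>.\<close>

lemma (in model_surface) open_same_orientation:
  assumes "z \<in> S"
  obtains T where "open T" "z \<in> T" "T \<subseteq> S" "\<And>y. y \<in> T \<Longrightarrow> \<epsilon> y = \<epsilon> z"
proof -
  have c: "continuous_on S (\<lambda>z. D f z v $ i)" for v i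
    using Df_differentiable open_S
    by (intro continuous_intros continuous_at_imp_continuous_on ballI differentiable_imp_continuous_within) auto
  have "continuous_on S (\<lambda>y. jac y * jac z)"
    unfolding jac_def by (intro continuous_intros c)
  then have "open (S \<inter> (\<lambda>y. jac y * jac z) -` {0<..})"
    using open_S by (rule continuous_open_preimage) simp
  moreover have "jac z < 0 \<or> 0 < jac z" unfolding linorder_neq_iff[symmetric]
    using l_jac[OF assms] det_metric_matrix(2)[OF assms] \<mu>_pos[OF assms] r_pos[OF assms] by auto
  moreover have "sgn x = sgn y" if "x * y > 0" for x y :: real
    using that by (auto simp: sgn_if zero_less_mult_iff)
  ultimately show thesis
    using that[of "S \<inter> (\<lambda>y. jac y * jac z) -` {0<..}"] assms
    by (auto simp: \<epsilon>_jac zero_less_mult_iff)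
qed

lemma graph_derivative:
  fixes f :: "complex \<Rightarrow> real^3"
  assumes "open S" "z \<in> S" and f: "f differentiable (at z)"
    and u: "u differentiable (at (base_coords (f z)))"
    and graph: "\<And>y. y \<in> S \<Longrightarrow> f y $ 3 = u (base_coords (f y))"
  shows "D f z v $ 3 = D u (base_coords (f z)) (1, 0) * D f z v $ 1 + D u (base_coords (f z)) (0, 1) * D f z v $ 2"
proof -
  have f': "(f has_derivative D f z) (at z)" using f by (simp add: frechet_derivative_works)
  have n: "((\<lambda>z. f z $ i) has_derivative (\<lambda>v. D f z v $ i)) (at z)" for i
    using f' by (rule bounded_linear.has_derivative[OF bounded_linear_vec_nth])
  have "((\<lambda>z. base_coords (f z)) has_derivative (\<lambda>v. (D f z v $ 1, D f z v $ 2))) (at z)"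
    unfolding base_coords_def by (intro has_derivative_Pair n)
  moreover have u': "(u has_derivative D u (base_coords (f z))) (at (base_coords (f z)))"
    using u by (simp add: frechet_derivative_works)
  ultimately have "((\<lambda>z. u (base_coords (f z))) has_derivative
      (\<lambda>v. D u (base_coords (f z)) (D f z v $ 1, D f z v $ 2))) (at z)"
    using has_derivative_compose by blast
  then have "((\<lambda>z. f z $ 3) has_derivative
      (\<lambda>v. D u (base_coords (f z)) (D f z v $ 1, D f z v $ 2))) (at z)"
    using assms(1,2) by (rule has_derivative_transform_within_open) (simp add: graph)
  from has_derivative_unique[OF n[of 3] this]
  have "D f z v $ 3 = D u (base_coords (f z)) (D f z v $ 1, D f z v $ 2)" by meson
  also have "\<dots> = D u (base_coords (f z)) (D f z v $ 1 *\<^sub>R (1, 0) + D f z v $ 2 *\<^sub>R (0, 1))" by simp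
  also have "\<dots> = D f z v $ 1 *\<^sub>R D u (base_coords (f z)) (1, 0) + D f z v $ 2 *\<^sub>R D u (base_coords (f z)) (0, 1)"
    using has_derivative_linear[OF u'] by (simp only: linear_add linear_cmul)
  finally show ?thesis by (simp add: mult.commute)
qed

section \<open>The algebra behind the identity\<close>

text \<open>Here aij is the derivative of hi in direction j and rj that of r. The last summand is i
  times the Hopf coefficient of the dual surface, whose one-form is (e h2, - e h1) and whose 1 /
  \<mu>' is \<mu>. Once r1' and r2' are eliminated, only the curl and the divergence of h
  survive.\<close>

lemma hopf_twin_algebra:
  fixes e \<tau> H r \<mu> h1 h2 :: real
  assumes e: "e * e = 1" and "r > 0" "\<mu> > 0" "r' > 0"
    and r': "r' = r - h1\<^sup>2 - h2\<^sup>2" and \<mu>: "r * \<mu>\<^sup>2 = r'"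
    and curl: "a21 - a12 = - 2 * \<tau> * e * \<mu> * r" and div: "a11 + a22 = 2 * H * \<mu> * r"
    and r1': "r1' = r1 - 2 * h1 * a11 - 2 * h2 * a21" and r2': "r2' = r2 - 2 * h1 * a12 - 2 * h2 * a22"
  shows "2 * (complex_of_real H - \<i> * complex_of_real \<tau>) * (Complex h1 (- e * h2))\<^sup>2
     + Complex (a11 - a22 - (r1 * h1 - r2 * h2) / r) (- e * (a12 + a21 - (r2 * h1 + r1 * h2) / r)) / \<mu>
     + \<i> * (Complex (e * (a21 + a12) - (r1' * (e * h2) + r2' * (e * h1)) / r')
         (- e * (e * (a22 - a11) - (r2' * (e * h2) - r1' * (e * h1)) / r')) * \<mu>) = 0"
proof -
  define A B A' B' where "A = a11 - a22 - (r1 * h1 - r2 * h2) / r" and "B = a12 + a21 - (r2 * h1 + r1 * h2) / r"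
    and "A' = e * (a21 + a12) - (r1' * (e * h2) + r2' * (e * h1)) / r'"
    and "B' = e * (a22 - a11) - (r2' * (e * h2) - r1' * (e * h1)) / r'"
  have A: "r * A = r * (a11 - a22) - (r1 * h1 - r2 * h2)" "r * B = r * (a12 + a21) - (r2 * h1 + r1 * h2)"
    "r' * A' = e * (r' * (a21 + a12) - (r1' * h2 + r2' * h1))"
    "r' * B' = e * (r' * (a22 - a11) - (r2' * h2 - r1' * h1))"
    using assms(2,4) by (simp_all add: A_def B_def A'_def B'_def field_simps)
  \<comment> \<open>The real part, multiplied by r \<mu> to remove all denominators; r' = r \<mu>^2
    supplies the same factor in the dual term.\<close>
  have "r * A + e * (r' * B') = - (h1\<^sup>2 - h2\<^sup>2) * (a11 + a22) - 2 * h1 * h2 * (a21 - a12)"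
    unfolding A r1' r2' using r' e by algebra
  then have "r * \<mu> * (A / \<mu> + e * B' * \<mu> + 2 * H * (h1\<^sup>2 - h2\<^sup>2) - 2 * \<tau> * e * (2 * h1 * h2)) = 0"
    unfolding curl div \<mu>[symmetric] using \<open>\<mu> > 0\<close> by (simp add: field_simps power2_eq_square)
  then have Re: "A / \<mu> + e * B' * \<mu> + 2 * H * (h1\<^sup>2 - h2\<^sup>2) - 2 * \<tau> * e * (2 * h1 * h2) = 0"
    using assms(2,3) by simp
  \<comment> \<open>The imaginary part, multiplied by r \<mu> as well.\<close>
  have "- e * (r * B) + r' * A' = e * (2 * h1 * h2 * (a11 + a22) - (h1\<^sup>2 - h2\<^sup>2) * (a21 - a12))"
    unfolding A r1' r2' using r' e by algebra
  also have "\<dots> = r * \<mu> * (e * (2 * h1 * h2 * (2 * H)) + (e * e) * (2 * \<tau> * (h1\<^sup>2 - h2\<^sup>2)))"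
    unfolding curl div by (simp add: algebra_simps)
  finally have "r * \<mu> * (- e * B / \<mu> + A' * \<mu> - 2 * e * H * (2 * h1 * h2) - 2 * \<tau> * (h1\<^sup>2 - h2\<^sup>2)) = 0"
    unfolding \<mu>[symmetric] e using \<open>\<mu> > 0\<close> by (simp add: field_simps power2_eq_square)
  then have Im: "- e * B / \<mu> + A' * \<mu> - 2 * e * H * (2 * h1 * h2) - 2 * \<tau> * (h1\<^sup>2 - h2\<^sup>2) = 0"
    using assms(2,3) by simp
  have "2 * (complex_of_real H - \<i> * complex_of_real \<tau>) * (Complex h1 (- e * h2))\<^sup>2
      = Complex (2 * H * (h1 * h1 - (e * e) * (h2 * h2)) - 2 * \<tau> * e * (2 * h1 * h2))
         (- 2 * e * H * (2 * h1 * h2) - 2 * \<tau> * (h1 * h1 - (e * e) * (h2 * h2)))"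
    by (simp add: complex_eq_iff power2_eq_square algebra_simps)
  also have "\<dots> = Complex (- A / \<mu> - e * B' * \<mu>) (e * B / \<mu> - A' * \<mu>)"
    unfolding e using Re Im by (simp add: complex_eq_iff power2_eq_square)
  finally show ?thesis
    unfolding A_def[symmetric] B_def[symmetric] A'_def[symmetric] B'_def[symmetric]
    by (simp add: complex_eq_iff algebra_simps)
qed

text \<open>Put K = \<kappa> - 4 \<tau>^2 and C = H + i \<tau> with conjugate C'; then \<kappa> + 4
  H^2 = K + 4 C C'. If K is nonzero, the first and the last equation give K (b + b') = 2 K C' a. If
  K = 0 and C is nonzero, the first gives b = 0 and the second b' = 2 C' a. If both vanish, then
  \<kappa> = \<tau> = H = 0, and \<open>degenerate\<close> is the only condition that restricts b
  and b'.\<close>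

lemma coefficient_relation:
  fixes a b a' b' :: complex and \<kappa> \<tau> H :: real
  assumes 1: "complex_of_real (\<kappa> - 4 * \<tau>\<^sup>2) * a + 2 * (complex_of_real H + \<i> * complex_of_real \<tau>) * b = 0"
    and 2: "complex_of_real (\<kappa> + 4 * H\<^sup>2) * a' + 2 * \<i> * (complex_of_real H + \<i> * complex_of_real \<tau>) * b' = 0"
    and a': "a' = - \<i> * a"
    and 3: "complex_of_real (\<kappa> - 4 * \<tau>\<^sup>2) * b' + complex_of_real (\<kappa> + 4 * H\<^sup>2) * b = 0"
    and degenerate: "\<kappa> = 0 \<and> \<tau> = 0 \<and> H = 0 \<longrightarrow> b' = - b"
  shows "b + b' = 2 * (complex_of_real H - \<i> * complex_of_real \<tau>) * a"
proof -
  define K C C' where "K = complex_of_real (\<kappa> - 4 * \<tau>\<^sup>2)"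
    and "C = complex_of_real H + \<i> * complex_of_real \<tau>" and "C' = complex_of_real H - \<i> * complex_of_real \<tau>"
  have K': "complex_of_real (\<kappa> + 4 * H\<^sup>2) = K + 4 * (C * C')"
    by (simp add: K_def C_def C'_def complex_eq_iff power2_eq_square algebra_simps)
  have 1: "K * a + 2 * C * b = 0" and 2: "(K + 4 * (C * C')) * (- \<i> * a) + 2 * \<i> * C * b' = 0"
    and 3: "K * b' + (K + 4 * (C * C')) * b = 0"
    using 1 2 3 unfolding a' K' K_def C_def C'_def by simp_all
  have "K * (b + b') = K * (2 * C' * a)" using 1 3 by algebra
  then have K0: "b + b' = 2 * C' * a" if "K \<noteq> 0" using that by simp
  have C0: "b + b' = 2 * C' * a" if "K = 0" "C \<noteq> 0"
  proof -
    have "b = 0" using 1 that by simp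
    moreover have "\<i> * C * 2 * (b' - 2 * C' * a) = 0" using 2 that by (simp add: algebra_simps)
    ultimately show ?thesis using that by simp
  qed
  have "b + b' = 2 * C' * a" if "K = 0" "C = 0"
  proof -
    have "H = 0" "\<tau> = 0" using that(2) by (auto simp: C_def complex_eq_iff)
    moreover from this have "\<kappa> = 0" using that(1) unfolding K_def of_real_eq_0_iff by simp
    ultimately show ?thesis using degenerate by (simp add: C'_def)
  qed
  with K0 C0 show ?thesis unfolding C'_def by blast
qed

text \<open>Both surfaces are graphs with the same parameters and the same base coordinates, so the
  twin relations compare their one-forms pointwise. The common base metric then relates r and r',
  and the two bundle curvatures give the curls of both forms.\<close>

lemma twin_quadratic:
  assumes "model_surface \<kappa> 1 \<tau> S f r" and "model_surface \<kappa> (- 1) (- H) S f' r'" and z: "z \<in> S"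
    and base: "\<And>y. y \<in> S \<Longrightarrow> base_coords (f' y) = base_coords (f y)"
    and R: "\<And>y. y \<in> S \<Longrightarrow> base_coords (f y) \<in> R"
    and u: "\<And>q. q \<in> R \<Longrightarrow> u differentiable (at q)" and v: "\<And>q. q \<in> R \<Longrightarrow> v differentiable (at q)"
    and fu: "\<And>y. y \<in> S \<Longrightarrow> f y $ 3 = u (base_coords (f y))"
    and fv: "\<And>y. y \<in> S \<Longrightarrow> f' y $ 3 = v (base_coords (f' y))"
    and twin: "twin_relations \<kappa> \<tau> H R u v"
    and a': "a' = - \<i> * a" and b': "b + b' = 2 * (complex_of_real H - \<i> * complex_of_real \<tau>) * a"
  shows "pullback_quad_diff (kmetric \<kappa> 1 \<tau>) a b f z x w =
    pullback_quad_diff (kmetric \<kappa> (- 1) (- H)) a' b' f' z x w"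
proof -
  interpret E: model_surface \<kappa> 1 \<tau> S f r by fact
  interpret L: model_surface \<kappa> "- 1" "- H" S f' r' by fact
  have nth: "f' y $ 1 = f y $ 1" "f' y $ 2 = f y $ 2" if "y \<in> S" for y
    using base[OF that] by (simp_all add: base_coords_def)
  have D12: "D f' y v $ 1 = D f y v $ 1" "D f' y v $ 2 = D f y v $ 2" if y: "y \<in> S" for y v
    using D_transform[OF frechet_derivative_nth(2)[OF E.f_differentiable[OF y]] E.open_S y, of _ "\<lambda>y. f' y $ _"] nth
      frechet_derivative_nth(1)[OF E.f_differentiable[OF y]]
      frechet_derivative_nth(1)[OF L.f_differentiable[OF y]]
    by metis+
  have \<epsilon>: "L.\<epsilon> y = E.\<epsilon> y" if "y \<in> S" for y
    by (simp add: base_orientation_def D12[OF that])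
  \<comment> \<open>In the orthonormal coframe of the base, the conformal factor times dx and dy,
    the one-forms have coefficients (\<alpha>, \<beta>) and - (\<alpha>', \<beta>'). The base metric
    written with r' and the dual one-form provides the remaining hypotheses of
    \<open>twin_algebra\<close>.\<close>
  have rot: "E.h 1 y = - E.\<epsilon> y * L.h \<i> y \<and> E.h \<i> y = E.\<epsilon> y * L.h 1 y" if y: "y \<in> S" for y
  proof -
    define l where "l = conf_factor \<kappa> (f y $ 1) (f y $ 2)"
    define \<alpha> \<beta> where "\<alpha> = D u (base_coords (f y)) (1, 0) / l + \<tau> * f y $ 2"
      and "\<beta> = D u (base_coords (f y)) (0, 1) / l - \<tau> * f y $ 1"
    define \<alpha>' \<beta>' where "\<alpha>' = D v (base_coords (f y)) (1, 0) / l - H * f y $ 2"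
      and "\<beta>' = D v (base_coords (f y)) (0, 1) / l + H * f y $ 1"
    have l: "l > 0" unfolding l_def using E.f_in_P[OF y] by (rule conf_factor_pos)
    have hE: "E.h x y = \<alpha> * (l * D f y x $ 1) + \<beta> * (l * D f y x $ 2)" for x
      using graph_derivative[OF E.open_S y E.f_differentiable[OF y] u[OF R[OF y]] fu, of x] l
      by (simp add: E.h_kform kform_def l_def[symmetric] \<alpha>_def \<beta>_def field_simps)
    have hL: "L.h x y = - (\<alpha>' * (l * D f y x $ 1) + \<beta>' * (l * D f y x $ 2))" for x
      using graph_derivative[OF L.open_S y L.f_differentiable[OF y] _ fv, of x] v[OF R[OF y]] l
      by (simp add: L.h_kform kform_def nth[OF y] base[OF y] D12[OF y] l_def[symmetric] \<alpha>'_def \<beta>'_def field_simps)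
    have m: "l * D f y x $ 1 * (l * D f y w $ 1) + l * D f y x $ 2 * (l * D f y w $ 2)
        = r' y * (x \<bullet> w) + L.h x y * L.h w y" for x w
      using L.base_metric[OF y, of x w]
      by (simp add: nth[OF y] D12[OF y] l_def[symmetric] power2_eq_square algebra_simps)
    have t: "\<alpha> = \<beta>' / sqrt (1 - \<alpha>'\<^sup>2 - \<beta>'\<^sup>2)" "\<beta> = - \<alpha>' / sqrt (1 - \<alpha>'\<^sup>2 - \<beta>'\<^sup>2)"
      using twin R[OF y] unfolding twin_relations_def Let_def
      by (auto simp: base_coords_def \<alpha>_def \<beta>_def \<alpha>'_def \<beta>'_def l_def)
    note tw = twin_algebra[OF L.r_pos[OF y] _ _ _ hL[of 1] hL[of \<i>] t]
    have "sgn (l * D f y 1 $ 1 * (l * D f y \<i> $ 2) - l * D f y 1 $ 2 * (l * D f y \<i> $ 1)) = sgn (l * l * E.jac y)"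
      by (simp add: E.jac_def algebra_simps)
    also have "\<dots> = E.\<epsilon> y" using l by (simp add: sgn_mult E.\<epsilon>_jac)
    finally show ?thesis using tw m[of 1 1] m[of \<i> \<i>] m[of 1 \<i>] by (simp add: hE)
  qed
  have ee: "E.\<epsilon> y * E.\<epsilon> y = 1" if "y \<in> S" for y using E.det_metric_matrix(2)[OF that] .
  have L1: "L.h 1 y = E.\<epsilon> y * E.h \<i> y" and L2: "L.h \<i> y = - E.\<epsilon> y * E.h 1 y" if y: "y \<in> S" for y
    using rot[OF y] ee[OF y] by algebra+
  \<comment> \<open>Both surfaces pull back the same base metric: r - h1^2 equals r' plus the square
    of the first dual component, which is h2^2.\<close>
  have r': "r' y = r y - (E.h 1 y)\<^sup>2 - (E.h \<i> y)\<^sup>2" if y: "y \<in> S" for y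
  proof -
    have "r y - E.h 1 y * E.h 1 y = r' y + (E.\<epsilon> y * E.\<epsilon> y) * (E.h \<i> y * E.h \<i> y)"
      using E.base_metric[OF y, of 1 1] L.base_metric[OF y, of 1 1]
      by (simp add: nth[OF y] D12[OF y] L1[OF y] mult_ac)
    then show ?thesis unfolding ee[OF y] by (simp add: power2_eq_square)
  qed
  define e where "e = E.\<epsilon> z"
  \<comment> \<open>On T the sign is the constant e, so the relations between the one-forms can be
    differentiated at z.\<close>
  obtain T where T: "open T" "z \<in> T" "T \<subseteq> S" and e: "\<And>y. y \<in> T \<Longrightarrow> E.\<epsilon> y = e"
    using E.open_same_orientation[OF z] unfolding e_def by blast
  have dh: "(E.h x has_derivative D (E.h x) z) (at z)" for x
    using E.h_differentiable[OF z] by (simp add: frechet_derivative_works)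
  have dr: "(r has_derivative D r z) (at z)"
    using E.r_differentiable[OF z] by (simp add: frechet_derivative_works)
  have DL1: "D (L.h 1) z x = e * D (E.h \<i>) z x" for x
  proof -
    have "((\<lambda>y. e * E.h \<i> y) has_derivative (\<lambda>x. e * D (E.h \<i>) z x)) (at z)"
      by (intro has_derivative_mult_right dh)
    then have "(L.h 1 has_derivative (\<lambda>x. e * D (E.h \<i>) z x)) (at z)"
      using T(1,2) by (rule has_derivative_transform_within_open) (use T(3) L1 e in auto)
    then show ?thesis by (simp add: frechet_derivative_eqI)
  qed
  have DL2: "D (L.h \<i>) z x = - e * D (E.h 1) z x" for x
  proof -
    have "((\<lambda>y. - e * E.h 1 y) has_derivative (\<lambda>x. - e * D (E.h 1) z x)) (at z)"
      by (intro has_derivative_mult_right dh)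
    then have "(L.h \<i> has_derivative (\<lambda>x. - e * D (E.h 1) z x)) (at z)"
      using T(1,2) by (rule has_derivative_transform_within_open) (use T(3) L2 e in auto)
    then show ?thesis by (simp add: frechet_derivative_eqI)
  qed
  have Dr: "D r' z x = D r z x - 2 * E.h 1 z * D (E.h 1) z x - 2 * E.h \<i> z * D (E.h \<i>) z x" for x
  proof -
    have "((\<lambda>y. r y - E.h 1 y * E.h 1 y - E.h \<i> y * E.h \<i> y) has_derivative
        (\<lambda>x. D r z x - (E.h 1 z * D (E.h 1) z x + D (E.h 1) z x * E.h 1 z)
          - (E.h \<i> z * D (E.h \<i>) z x + D (E.h \<i>) z x * E.h \<i> z))) (at z)"
      by (intro has_derivative_diff has_derivative_mult dh dr)
    then have "(r' has_derivative
        (\<lambda>x. D r z x - (E.h 1 z * D (E.h 1) z x + D (E.h 1) z x * E.h 1 z)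
          - (E.h \<i> z * D (E.h \<i>) z x + D (E.h \<i>) z x * E.h \<i> z))) (at z)"
      using T(1,2) by (rule has_derivative_transform_within_open)
        (use T(3) r' in \<open>auto simp: power2_eq_square\<close>)
    then show ?thesis by (simp add: frechet_derivative_eqI)
  qed
  have ez: "E.\<epsilon> z = e" "L.\<epsilon> z = e" and e1: "e * e = 1" using \<epsilon>[OF z] ee[OF z] by (simp_all add: e_def)
  have r\<mu>: "r z * (E.\<mu> z)\<^sup>2 = r' z"
    using E.r_pos[OF z] by (simp add: E.\<mu>_square[OF z] r'[OF z] field_simps)
  \<comment> \<open>Here \<mu>^2 = r' / r for the first surface and r / r' for the dual one, so the
    two moduli are reciprocal.\<close>
  have "(L.\<mu> z)\<^sup>2 * r' z = r z"
  proof -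
    have "(L.\<mu> z)\<^sup>2 * r' z = r' z + ((L.h 1 z)\<^sup>2 + (L.h \<i> z)\<^sup>2)"
      using L.r_pos[OF z] by (simp add: L.\<mu>_square[OF z] field_simps)
    moreover have "(L.h 1 z)\<^sup>2 = (E.h \<i> z)\<^sup>2" "(L.h \<i> z)\<^sup>2 = (E.h 1 z)\<^sup>2"
      by (simp_all add: L1[OF z] L2[OF z] ez power_mult_distrib power2_eq_square[of e] e1)
    ultimately show ?thesis by (simp add: r'[OF z])
  qed
  then have "(L.\<mu> z * E.\<mu> z)\<^sup>2 * r z = 1\<^sup>2 * r z" by (simp add: power_mult_distrib r\<mu>[symmetric] mult_ac)
  then have "(L.\<mu> z * E.\<mu> z)\<^sup>2 = 1\<^sup>2" using E.r_pos[OF z] by simp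
  then have "L.\<mu> z * E.\<mu> z = 1"
    by (rule power2_eq_imp_eq) (use L.\<mu>_pos[OF z] E.\<mu>_pos[OF z] in auto)
  then have \<mu>: "1 / L.\<mu> z = E.\<mu> z" using L.\<mu>_pos[OF z] by (simp add: field_simps)
  have curl: "D (E.h \<i>) z 1 - D (E.h 1) z \<i> = - 2 * \<tau> * e * E.\<mu> z * r z"
    using E.curl_h[OF z] by (simp add: ez)
  \<comment> \<open>The curl of the dual one-form, with s = -1 and t = - H, is - e times the
    divergence of the original one; moreover the products of \<mu> and r agree for both
    surfaces.\<close>
  have div: "D (E.h 1) z 1 + D (E.h \<i>) z \<i> = 2 * H * E.\<mu> z * r z"
  proof -
    have "- e * (D (E.h 1) z 1 + D (E.h \<i>) z \<i>) = - e * (2 * H * (L.\<mu> z * r' z))"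
      using L.curl_h[OF z] by (simp add: ez DL1 DL2 algebra_simps)
    then have "D (E.h 1) z 1 + D (E.h \<i>) z \<i> = 2 * H * (L.\<mu> z * r' z)" using e1 by auto
    also have "L.\<mu> z * r' z = (L.\<mu> z * E.\<mu> z) * (E.\<mu> z * r z)"
      by (simp add: r\<mu>[symmetric] power2_eq_square mult_ac)
    finally show ?thesis using \<open>L.\<mu> z * E.\<mu> z = 1\<close> by simp
  qed
  note alg = hopf_twin_algebra[OF e1 E.r_pos[OF z] E.\<mu>_pos[OF z] L.r_pos[OF z] r'[OF z] r\<mu> curl div
      Dr[of 1] Dr[of \<i>]]
  have EH: "E.hopf z = Complex (D (E.h 1) z 1 - D (E.h \<i>) z \<i> - (D r z 1 * E.h 1 z - D r z \<i> * E.h \<i> z) / r z)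
       (- e * (D (E.h 1) z \<i> + D (E.h \<i>) z 1 - (D r z \<i> * E.h 1 z + D r z 1 * E.h \<i> z) / r z)) / E.\<mu> z"
    by (simp add: E.hopf_def ez)
  have LH: "L.hopf z = Complex (e * (D (E.h \<i>) z 1 + D (E.h 1) z \<i>) - (D r' z 1 * (e * E.h \<i> z) + D r' z \<i> * (e * E.h 1 z)) / r' z)
         (- e * (e * (D (E.h \<i>) z \<i> - D (E.h 1) z 1) - (D r' z \<i> * (e * E.h \<i> z) - D r' z 1 * (e * E.h 1 z)) / r' z)) * E.\<mu> z"
  proof -
    have "L.hopf z = Complex (e * (D (E.h \<i>) z 1 + D (E.h 1) z \<i>) - (D r' z 1 * (e * E.h \<i> z) + D r' z \<i> * (e * E.h 1 z)) / r' z)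
         (- e * (e * (D (E.h \<i>) z \<i> - D (E.h 1) z 1) - (D r' z \<i> * (e * E.h \<i> z) - D r' z 1 * (e * E.h 1 z)) / r' z))
         * of_real (1 / L.\<mu> z)"
      by (simp add: L.hopf_def ez L1[OF z] L2[OF z] DL1 DL2 right_diff_distrib distrib_left)
    then show ?thesis by (simp only: \<mu>)
  qed
  \<comment> \<open>Rotating the one-form multiplies its complex coefficient by i, so the square
    changes sign; therefore b and b' end up in a sum.\<close>
  have hL: "Complex (L.h 1 z) (- e * L.h \<i> z) = \<i> * Complex (E.h 1 z) (- e * E.h \<i> z)"
    using e1 by (simp add: complex_eq_iff L1[OF z] L2[OF z] ez mult.assoc[symmetric])
  have "2 * (complex_of_real H - \<i> * complex_of_real \<tau>) * (Complex (E.h 1 z) (- e * E.h \<i> z))\<^sup>2 + E.hopf z + \<i> * L.hopf z = 0"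
    unfolding EH LH by (rule alg)
  then have "a * E.hopf z + b * (Complex (E.h 1 z) (- e * E.h \<i> z))\<^sup>2 =
     a' * L.hopf z + b' * (Complex (L.h 1 z) (- e * L.h \<i> z))\<^sup>2"
    unfolding hL power_mult_distrib power2_i a' using b' by algebra
  then show ?thesis
    unfolding E.pullback_quad_diff_eq[OF z] L.pullback_quad_diff_eq[OF z] ez by simp
qed

section \<open>Local representations in different charts\<close>

lemma kmetric_pos:
  assumes "p \<in> model_space \<kappa>" "u \<noteq> 0" shows "kmetric \<kappa> 1 t p u u > 0"
proof (rule ccontr)
  let ?l = "conf_factor \<kappa> (p$1) (p$2)"
  assume "\<not> kmetric \<kappa> 1 t p u u > 0"
  then have "?l\<^sup>2 * (u$1 * u$1 + u$2 * u$2) + (kform \<kappa> t p u)\<^sup>2 \<le> 0"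
    by (simp add: kmetric_def power2_eq_square)
  moreover have "?l\<^sup>2 * (u$1 * u$1 + u$2 * u$2) \<ge> 0" by simp
  ultimately have 1: "?l\<^sup>2 * (u$1 * u$1 + u$2 * u$2) = 0" and 2: "kform \<kappa> t p u = 0"
    using zero_le_power2[of "kform \<kappa> t p u"] by (smt (verit) power2_eq_iff_nonneg zero_eq_power2)+
  from 1 have 3: "u$1 = 0" "u$2 = 0"
    using conf_factor_pos[OF assms(1)] by (auto simp: sum_squares_eq_zero_iff)
  then have "u$3 = 0" using 2 by (simp add: kform_def)
  with 3 assms(2) show False by (simp add: vec_eq_iff forall_3)
qed

lemma riemann_surface_open_image:
  assumes "riemann_surface A" "(W, \<zeta>) \<in> A" "open N"
  shows "open (\<zeta> ` (W \<inter> N))"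
proof -
  have "open (\<zeta> ` W)" and h: "homeomorphism W (\<zeta> ` W) \<zeta> (inv_into W \<zeta>)"
    using assms(1,2) unfolding riemann_surface_def by auto
  moreover have "openin (top_of_set (\<zeta> ` W)) (\<zeta> ` (W \<inter> N))"
    using h by (rule homeomorphism_imp_open_map) (use assms(3) in auto)
  ultimately show ?thesis by (simp add: openin_open_eq)
qed

lemma inv_chart:
  assumes "riemann_surface A" "(W, \<zeta>) \<in> A" "p \<in> W"
  shows "inv_into W \<zeta> (\<zeta> p) = p"
proof -
  have "homeomorphism W (\<zeta> ` W) \<zeta> (inv_into W \<zeta>)"
    using assms(1,2) unfolding riemann_surface_def by auto
  then show ?thesis using assms(3) by (rule homeomorphism_apply1)
qed

lemma local_rep_at:
  assumes "riemann_surface A" "(W, \<zeta>) \<in> A" "p \<in> W"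
  shows "local_rep (W, \<zeta>) (U, \<Phi>, V, \<phi>) X (\<zeta> p) = \<Phi> (X p)"
  by (simp add: local_rep_def inv_chart[OF assms])

lemma model_chartD:
  assumes "killing_space_over g \<kappa> M" "(U, \<Phi>, V, \<phi>) \<in> model_charts M"
  shows "open U" "inj_on \<Phi> U" "(V, \<phi>) \<in> M2_charts \<kappa>" "\<And>p. p \<in> U \<Longrightarrow> \<Phi> p \<in> model_space \<kappa>"
    "\<And>p. p \<in> U \<Longrightarrow> base_proj M p \<in> V \<and> base_coords (\<Phi> p) = \<phi> (base_proj M p)"
proof -
  have "is_model_chart \<kappa> (base_proj M) (U, \<Phi>, V, \<phi>)"
    using assms unfolding killing_space_over_def by blast
  then have c: "open U" "homeomorphism U (\<Phi> ` U) \<Phi> (inv_into U \<Phi>)"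
    "base_coords ` \<Phi> ` U \<subseteq> Omega \<kappa>" "(V, \<phi>) \<in> M2_charts \<kappa>"
    "\<forall>p\<in>U. base_proj M p \<in> V \<and> base_coords (\<Phi> p) = \<phi> (base_proj M p)"
    unfolding is_model_chart_def prod.case by blast+
  show "open U" "(V, \<phi>) \<in> M2_charts \<kappa>" by fact+
  show "base_proj M p \<in> V \<and> base_coords (\<Phi> p) = \<phi> (base_proj M p)" if "p \<in> U" for p
    using c(5) that by (rule bspec)
  show "\<Phi> p \<in> model_space \<kappa>" if "p \<in> U" for p
    using c(3) that unfolding model_space_def by blast
  show "inj_on \<Phi> U" using c(2) by (intro inj_on_inverseI) (rule homeomorphism_apply1)
qed

lemma everywhere_locallyD:
  assumes "everywhere_locally A M X P" "(W, \<zeta>) \<in> A" "(U, \<Phi>, V, \<phi>) \<in> model_charts M" "p \<in> W" "X p \<in> U"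
  shows "P (local_rep (W, \<zeta>) (U, \<Phi>, V, \<phi>) X) (\<zeta> p)"
  using assms(1)[unfolded everywhere_locally_def, THEN bspec[OF _ assms(2)], unfolded prod.case,
      THEN bspec[OF _ assms(3)], unfolded prod.case] assms(4,5) by blast

text \<open>The conformal factor is read off at the unit parameter vector 1. The condition that
  needs an argument is transversality, by signature: for s = 1 it is positivity of the squared
  length of the normal part of \<open>e3\<close>.\<close>

lemma local_rep_model_surface:
  assumes "riemann_surface A" "killing_space_over (kmetric \<kappa> s t) \<kappa> M"
    and X: "conformal_immersion (kmetric \<kappa> s t) A M X"
    and W: "(W, \<zeta>) \<in> A" and U: "(U, \<Phi>, V, \<phi>) \<in> model_charts M"
    and s: "s = 1 \<and> nowhere_vertical A M X \<or> s = - 1"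
    and f_def: "f = local_rep (W, \<zeta>) (U, \<Phi>, V, \<phi>) X"
  shows "model_surface \<kappa> s t (\<zeta> ` (W \<inter> X -` U)) f (\<lambda>z. kmetric \<kappa> s t (f z) (D f z 1) (D f z 1))"
proof -
  let ?g = "kmetric \<kappa> s t" and ?S = "\<zeta> ` (W \<inter> X -` U)"
  define r where "r z = ?g (f z) (D f z 1) (D f z 1)" for z
  have s2: "s * s = 1" using s by auto
  interpret killing_metric ?g "model_space \<kappa>" s by (rule killing_metric_kmetric[OF s2])
  have "open (X -` U)"
    using X model_chartD(1)[OF assms(2) U] unfolding conformal_immersion_def
    by (simp add: continuous_on_open_vimage)
  then have S: "open ?S" by (rule riemann_surface_open_image[OF assms(1) W])
  have "smooth_on ?S f" using X W U unfolding conformal_immersion_def f_def by auto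
  then have "Ck_on (Suc (Suc 0)) ?S f" by (simp add: smooth_on_def del: Ck_on.simps)
  then have smooth: "f differentiable (at z)" "(\<lambda>z. D f z v) differentiable (at z)" if "z \<in> ?S" for z v
    using that by auto
  have inP: "f z \<in> model_space \<kappa>" if "z \<in> ?S" for z
  proof -
    obtain p where p: "p \<in> W" "X p \<in> U" "z = \<zeta> p" using \<open>z \<in> ?S\<close> by auto
    have "f z = \<Phi> (X p)" unfolding f_def p(3) by (rule local_rep_at[OF assms(1) W p(1)])
    then show ?thesis using model_chartD(4)[OF assms(2) U p(2)] by simp
  qed
  have conf: "r z > 0" "?g (f z) (D f z v) (D f z w) = r z * (v \<bullet> w)" if "z \<in> ?S" for z v w
  proof -
    obtain p where p: "p \<in> W" "X p \<in> U" "z = \<zeta> p" using \<open>z \<in> ?S\<close> by auto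
    have "everywhere_locally A M X (\<lambda>f z. inj (D f z) \<and>
        (\<exists>\<rho>>0. \<forall>v w. ?g (f z) (D f z v) (D f z w) = \<rho> * (v \<bullet> w)))"
      using X unfolding conformal_immersion_def by blast
    from everywhere_locallyD[OF this W U p(1,2)] obtain \<rho> where \<rho>: "\<rho> > 0" "\<And>v w. ?g (f z) (D f z v) (D f z w) = \<rho> * (v \<bullet> w)"
      unfolding f_def[symmetric] p(3)[symmetric] by blast
    then have "r z = \<rho>" by (simp add: r_def)
    then show "r z > 0" "?g (f z) (D f z v) (D f z w) = r z * (v \<bullet> w)" using \<rho> by simp_all
  qed
  have trans: "s * ((?g (f z) (D f z 1) e3)\<^sup>2 + (?g (f z) (D f z \<i>) e3)\<^sup>2) < r z"
    if z: "z \<in> ?S" for z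
    using s
  proof
    assume "s = - 1"
    then have "s * ((?g (f z) (D f z 1) e3)\<^sup>2 + (?g (f z) (D f z \<i>) e3)\<^sup>2) \<le> 0"
      by (intro mult_nonpos_nonneg) auto
    then show ?thesis using conf(1)[OF z] by simp
  next
    assume s1: "s = 1 \<and> nowhere_vertical A M X"
    obtain p where p: "p \<in> W" "X p \<in> U" "z = \<zeta> p" using \<open>z \<in> ?S\<close> by auto
    have vert: "e3 \<notin> range (D f z)"
      using everywhere_locallyD[OF s1[THEN conjunct2, unfolded nowhere_vertical_def] W U p(1,2)]
      unfolding f_def p(3) .
    define h1 h2 where "h1 = ?g (f z) (D f z 1) e3" and "h2 = ?g (f z) (D f z \<i>) e3"
    \<comment> \<open>Parameter vector of the tangential part of \<open>e3\<close>. As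
      \<open>e3\<close> is not tangent, it differs from this part, and the difference has the
      positive square 1 - (h1^2 + h2^2) / r.\<close>
    define c where "c = Complex (h1 / r z) (h2 / r z)"
    have r: "r z > 0" by (rule conf(1)[OF z])
    have lin: "linear (D f z)" using smooth(1)[OF z] by (rule linear_frechet_derivative)
    have "D f z c = D f z ((h1 / r z) *\<^sub>R 1 + (h2 / r z) *\<^sub>R \<i>)"
      by (rule arg_cong[of _ _ "D f z"]) (simp add: c_def complex_eq_iff)
    then have Fc: "D f z c = (h1 / r z) *\<^sub>R D f z 1 + (h2 / r z) *\<^sub>R D f z \<i>"
      by (simp only: linear_add[OF lin] linear_cmul[OF lin])
    have ce: "?g (f z) (D f z c) e3 = (h1\<^sup>2 + h2\<^sup>2) / r z"
      unfolding Fc g_simps h1_def[symmetric] h2_def[symmetric]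
      by (simp add: power2_eq_square add_divide_distrib)
    have "?g (f z) (D f z c) (D f z c) = r z * (c \<bullet> c)" by (rule conf(2)[OF z])
    also have "\<dots> = (h1\<^sup>2 + h2\<^sup>2) / r z" using r
      by (simp add: c_def inner_complex_def power2_eq_square add_divide_distrib distrib_left)
    finally have cc: "?g (f z) (D f z c) (D f z c) = (h1\<^sup>2 + h2\<^sup>2) / r z" .
    have "e3 - D f z c \<noteq> 0" using vert by auto
    then have "?g (f z) (e3 - D f z c) (e3 - D f z c) > 0"
      using kmetric_pos[OF inP[OF z]] s1 by simp
    moreover have "?g (f z) (e3 - D f z c) (e3 - D f z c) = 1 - (h1\<^sup>2 + h2\<^sup>2) / r z"
      unfolding bilinear_lsub[OF g_bilinear] bilinear_rsub[OF g_bilinear] cc g_sym[of _ e3 "D f z c"] ce g_e3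
      using s1 by simp
    ultimately have "(h1\<^sup>2 + h2\<^sup>2) / r z < 1" by linarith
    then show ?thesis
      using r s1 unfolding h1_def[symmetric] h2_def[symmetric] by (simp add: pos_divide_less_eq)
  qed
  show ?thesis
    unfolding r_def[abs_def, symmetric]
    by unfold_locales (use S smooth inP conf trans in auto)
qed

text \<open>By the chain rule the derivatives of the two representations differ by the derivative of
  the transition map, an isometry that fixes \<open>e3\<close>.\<close>

lemma chart_transfer:
  assumes "riemann_surface A" "killing_space_over g \<kappa> M"
    and W: "(W, \<zeta>) \<in> A"
    and C1: "(U1, \<Phi>1, V1, \<phi>1) \<in> model_charts M" and C: "(U, \<Phi>, V, \<phi>) \<in> model_charts M"
    and T: "open T" "z \<in> T" "T \<subseteq> \<zeta> ` (W \<inter> X -` U \<inter> X -` U1)"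
    and f1_def: "f1 = local_rep (W, \<zeta>) (U1, \<Phi>1, V1, \<phi>1) X" and f_def: "f = local_rep (W, \<zeta>) (U, \<Phi>, V, \<phi>) X"
    and f1: "f1 differentiable (at z)" and f: "f differentiable (at z)"
  shows "g (f z) (D f z v) (D f z w) = g (f1 z) (D f1 z v) (D f1 z w)"
    and "g (f z) (D f z v) e3 = g (f1 z) (D f1 z v) e3"
proof -
  define \<psi> where "\<psi> = \<Phi> \<circ> inv_into U1 \<Phi>1"
  have "compatible_charts g (U1, \<Phi>1, V1, \<phi>1) (U, \<Phi>, V, \<phi>)"
    using assms(2) C1 C unfolding killing_space_over_def by blast
  then have sm: "smooth_on (\<Phi>1 ` (U1 \<inter> U)) \<psi>"
    and iso: "\<And>p. p \<in> \<Phi>1 ` (U1 \<inter> U) \<Longrightarrow> D \<psi> p e3 = e3 \<and> (\<forall>u v. g (\<psi> p) (D \<psi> p u) (D \<psi> p v) = g p u v)"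
    unfolding compatible_charts_def Let_def \<psi>_def by auto
  have \<psi>: "f1 y \<in> \<Phi>1 ` (U1 \<inter> U) \<and> \<psi> (f1 y) = f y" if y: "y \<in> T" for y
  proof -
    obtain p where p: "p \<in> W" "X p \<in> U" "X p \<in> U1" "y = \<zeta> p" using T(3) y by auto
    have "f1 y = \<Phi>1 (X p)" "f y = \<Phi> (X p)"
      unfolding f1_def f_def p(4) by (rule local_rep_at[OF assms(1) W p(1)])+
    then show ?thesis
      using model_chartD(2)[OF assms(2) C1] p(2,3) by (simp add: \<psi>_def)
  qed
  have "Ck_on (Suc 0) (\<Phi>1 ` (U1 \<inter> U)) \<psi>" using sm by (simp add: smooth_on_def del: Ck_on.simps)
  then have "\<psi> differentiable (at (f1 z))" using \<psi>[OF T(2)] by auto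
  then have "D (\<psi> \<circ> f1) z = D \<psi> (f1 z) \<circ> D f1 z" using f1 by (rule frechet_derivative_compose[rotated])
  moreover have "D (\<psi> \<circ> f1) z = D f z"
    by (rule D_transform[OF f T(1,2)]) (simp add: \<psi>)
  ultimately have D: "D f z v = D \<psi> (f1 z) (D f1 z v)" for v by simp
  have z: "f1 z \<in> \<Phi>1 ` (U1 \<inter> U)" "f z = \<psi> (f1 z)" using \<psi>[OF T(2)] by auto
  show "g (f z) (D f z v) (D f z w) = g (f1 z) (D f1 z v) (D f1 z w)"
    using iso[OF z(1)] by (simp add: D z(2))
  have "g (f z) (D f z v) e3 = g (\<psi> (f1 z)) (D \<psi> (f1 z) (D f1 z v)) (D \<psi> (f1 z) e3)"
    using iso[OF z(1)] by (simp add: D z(2))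
  also have "\<dots> = g (f1 z) (D f1 z v) e3" using iso[OF z(1)] by blast
  finally show "g (f z) (D f z v) e3 = g (f1 z) (D f1 z v) e3" .
qed

section \<open>Orientation of the base charts and change of model charts\<close>

text \<open>Differentiating the constant product gives d' = q d with q = - c' / c. Multiplication by
  a nonzero complex number has determinant |q|^2 > 0, so z |-> K / z preserves orientation.\<close>

lemma orientation_of_product:
  fixes c c' :: "complex \<Rightarrow> complex"
  assumes "open T" "z \<in> T" and c: "(c has_derivative d) (at z)" and c': "(c' has_derivative d') (at z)"
    and K: "\<And>y. y \<in> T \<Longrightarrow> c y * c' y = K" "K \<noteq> 0"
  shows "sgn (Re (d 1) * Im (d \<i>) - Im (d 1) * Re (d \<i>)) = sgn (Re (d' 1) * Im (d' \<i>) - Im (d' 1) * Re (d' \<i>))"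
proof -
  have "((\<lambda>y. c y * c' y) has_derivative (\<lambda>v. c z * d' v + d v * c' z)) (at z)"
    using c c' by (rule has_derivative_mult)
  then have "((\<lambda>y. K) has_derivative (\<lambda>v. c z * d' v + d v * c' z)) (at z)"
    using assms(1,2) by (rule has_derivative_transform_within_open) (simp add: K)
  from has_derivative_unique[OF this has_derivative_const]
  have eq: "c z * d' v + d v * c' z = 0" for v by meson
  have nz: "c z \<noteq> 0" "c' z \<noteq> 0" using K(1)[OF assms(2)] K(2) by auto
  define q where "q = - c' z / c z"
  have d': "d' v = q * d v" for v using eq[of v] nz by (simp add: q_def field_simps eq_neg_iff_add_eq_0)
  have "Re (d' 1) * Im (d' \<i>) - Im (d' 1) * Re (d' \<i>) =
      ((Re q)\<^sup>2 + (Im q)\<^sup>2) * (Re (d 1) * Im (d \<i>) - Im (d 1) * Re (d \<i>))"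
    unfolding d' by (simp add: power2_eq_square algebra_simps)
  moreover have "(Re q)\<^sup>2 + (Im q)\<^sup>2 > 0"
    using nz by (simp add: q_def complex_neq_0[symmetric])
  ultimately show ?thesis by (simp add: sgn_mult)
qed

text \<open>The minus sign in the second chart makes the numerators conjugate. On the sphere the
  product of the denominators 1 + k p3 and 1 - k p3, with k = sqrt \<kappa>, is k^2 (p1^2 + p2^2),
  and their zeros are the excluded poles.\<close>

lemma stereographic_product:
  assumes "\<kappa> > 0" "p \<in> M2 \<kappa>" "p \<noteq> vector [0, 0, - 1 / sqrt \<kappa>]" "p \<noteq> vector [0, 0, 1 / sqrt \<kappa>]"
  shows "Complex (2 * p$1 / (1 + sqrt \<kappa> * p$3)) (2 * p$2 / (1 + sqrt \<kappa> * p$3)) *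
    Complex (2 * p$1 / (1 - sqrt \<kappa> * p$3)) (- 2 * p$2 / (1 - sqrt \<kappa> * p$3)) = complex_of_real (4 / \<kappa>)"
proof -
  define k where "k = sqrt \<kappa>"
  have k: "k > 0" "\<kappa> = k * k" using assms(1) by (simp_all add: k_def)
  have "norm p = 1 / k" using assms(1,2) by (simp add: M2_def k_def)
  then have "p \<bullet> p = (1 / k)\<^sup>2" by (simp add: power2_norm_eq_inner[symmetric])
  then have sph: "p$1 * p$1 + p$2 * p$2 + p$3 * p$3 = 1 / (k * k)"
    by (simp add: inner_vec_def sum_3 power2_eq_square)
  have nz: "1 + k * p$3 \<noteq> 0" "1 - k * p$3 \<noteq> 0"
  proof -
    have *: "p$1 = 0 \<and> p$2 = 0" if "p$3 * p$3 = 1 / (k * k)"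
      using sph that by (simp add: sum_squares_eq_zero_iff)
    show "1 + k * p$3 \<noteq> 0"
    proof
      assume "1 + k * p$3 = 0"
      then have "p$3 = - 1 / k" using k by (simp add: field_simps)
      then show False using * assms(3) by (simp add: vec_eq_iff forall_3 k_def)
    qed
    show "1 - k * p$3 \<noteq> 0"
    proof
      assume "1 - k * p$3 = 0"
      then have "p$3 = 1 / k" using k by (simp add: field_simps)
      then show False using * assms(4) by (simp add: vec_eq_iff forall_3 k_def)
    qed
  qed
  have "k * k * (p$1 * p$1 + p$2 * p$2 + p$3 * p$3) = 1" using sph k by simp
  then have "4 * (p$1 * p$1 + p$2 * p$2) * (k * k) = 4 * ((1 + k * p$3) * (1 - k * p$3))" by algebra
  then have "4 * (p$1 * p$1 + p$2 * p$2) / ((1 + k * p$3) * (1 - k * p$3)) = 4 / (k * k)"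
    using k nz by (subst frac_eq_eq) auto
  then show ?thesis unfolding k_def[symmetric] unfolding k(2)
    by (simp add: complex_eq_iff add_divide_distrib diff_divide_distrib distrib_left mult.assoc)
qed

text \<open>Here b is the common base point. Two charts of the base either coincide, and then so do
  the base coordinates, or are the two stereographic projections, whose product in the complex
  coordinate is constant.\<close>

lemma base_orientation_eq:
  fixes f f' :: "complex \<Rightarrow> real^3"
  assumes T: "open T" "z \<in> T" and f: "f differentiable (at z)" and f': "f' differentiable (at z)"
    and V: "(V, \<phi>) \<in> M2_charts \<kappa>" and V': "(V', \<phi>') \<in> M2_charts \<kappa>"
    and b: "\<And>y. y \<in> T \<Longrightarrow> b y \<in> V \<and> b y \<in> V' \<and> base_coords (f y) = \<phi> (b y) \<and> base_coords (f' y) = \<phi>' (b y)"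
  shows "base_orientation f z = base_orientation f' z"
proof -
  have dc: "((\<lambda>y. Complex (h y $ 1) (h y $ 2)) has_derivative (\<lambda>v. Complex (D h z v $ 1) (D h z v $ 2))) (at z)"
    if "h differentiable (at z)" for h :: "complex \<Rightarrow> real^3"
  proof -
    have n: "((\<lambda>y. h y $ i) has_derivative (\<lambda>v. D h z v $ i)) (at z)" for i
      using that by (intro bounded_linear.has_derivative[OF bounded_linear_vec_nth])
        (simp add: frechet_derivative_works)
    have "((\<lambda>y. of_real (h y $ 1) + \<i> * of_real (h y $ 2)) has_derivative
        (\<lambda>v. of_real (D h z v $ 1) + \<i> * of_real (D h z v $ 2))) (at z)"
      by (intro has_derivative_add has_derivative_mult_right bounded_linear.has_derivative[OF bounded_linear_of_real] n)
    then show ?thesis by (simp add: Complex_eq)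
  qed
  have eps: "base_orientation h z = sgn (Re (Complex (D h z 1 $ 1) (D h z 1 $ 2)) * Im (Complex (D h z \<i> $ 1) (D h z \<i> $ 2))
     - Im (Complex (D h z 1 $ 1) (D h z 1 $ 2)) * Re (Complex (D h z \<i> $ 1) (D h z \<i> $ 2)))" for h
    by (simp add: base_orientation_def)
  consider "\<phi> = \<phi>'"
    | (prod) "\<And>p. p \<in> V \<Longrightarrow> p \<in> V' \<Longrightarrow> Complex (fst (\<phi> p)) (snd (\<phi> p)) * Complex (fst (\<phi>' p)) (snd (\<phi>' p)) = complex_of_real (4 / \<kappa>)"
      "\<kappa> > 0"
  proof (cases "\<kappa> > 0")
    case True
    note st = stereographic_product[OF True]
    show thesis
      using V V' True that st unfolding M2_charts_def by (auto simp: mult.commute)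
  next
    case False
    then show thesis using V V' that(1) unfolding M2_charts_def by auto
  qed
  then show ?thesis
  proof cases
    case 1
    have eq: "Complex (f y $ 1) (f y $ 2) = Complex (f' y $ 1) (f' y $ 2)" if "y \<in> T" for y
    proof -
      have "base_coords (f y) = base_coords (f' y)" using b[OF that] 1 by simp
      then show ?thesis by (simp add: base_coords_def)
    qed
    have "((\<lambda>y. Complex (f' y $ 1) (f' y $ 2)) has_derivative (\<lambda>v. Complex (D f z v $ 1) (D f z v $ 2))) (at z)"
      using dc[OF f] T by (rule has_derivative_transform_within_open) (rule eq)
    from has_derivative_unique[OF this dc[OF f']]
    have "Complex (D f z v $ 1) (D f z v $ 2) = Complex (D f' z v $ 1) (D f' z v $ 2)" for v by meson
    then show ?thesis unfolding eps by simp
  next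
    case prod
    show ?thesis unfolding eps
    proof (rule orientation_of_product[OF T dc[OF f] dc[OF f']])
      show "complex_of_real (4 / \<kappa>) \<noteq> 0" using prod(2) by simp
      fix y assume "y \<in> T"
      from b[OF this] have "b y \<in> V" "b y \<in> V'"
        and "\<phi> (b y) = (f y $ 1, f y $ 2)" "\<phi>' (b y) = (f' y $ 1, f' y $ 2)"
        by (simp_all add: base_coords_def)
      with prod(1)[of "b y"]
      show "Complex (f y $ 1) (f y $ 2) * Complex (f' y $ 1) (f' y $ 2) = complex_of_real (4 / \<kappa>)" by simp
    qed
  qed
qed

lemma (in conformal_surface) pullback_quad_diff_cong:
  assumes "conformal_surface g P s S f2 r2" "z \<in> S"
    and "\<And>v y. y \<in> S \<Longrightarrow> g (f2 y) (D f2 y v) e3 = g (f y) (D f y v) e3"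
    and "\<And>y. y \<in> S \<Longrightarrow> r2 y = r y"
    and "base_orientation f2 z = \<epsilon> z"
  shows "pullback_quad_diff g a b f2 z v w = pullback_quad_diff g a b f z v w"
proof -
  interpret B: conformal_surface g P s S f2 r2 by fact
  have "B.h x z = h x z" for x using assms(2,3) by (simp add: B.h_def h_def)
  moreover have "B.hopf z = hopf z" by (rule hopf_cong[OF assms])
  ultimately show ?thesis
    unfolding B.pullback_quad_diff_eq[OF assms(2)] pullback_quad_diff_eq[OF assms(2)] assms(5) by simp
qed

text \<open>The transition map intertwines the one-forms $\langle f_v, e_3\rangle$ and the induced metrics,
  and these determine the quadratic differential up to the orientation of the base map.\<close>
lemma pullback_quad_diff_chart:
  assumes "riemann_surface A" "killing_space_over (kmetric \<kappa> s t) \<kappa> M"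
    and X: "conformal_immersion (kmetric \<kappa> s t) A M X"
    and W: "(W, \<zeta>) \<in> A"
    and C1: "(U1, \<Phi>1, V1, \<phi>1) \<in> model_charts M" and C: "(U, \<Phi>, V, \<phi>) \<in> model_charts M"
    and s: "s = 1 \<and> nowhere_vertical A M X \<or> s = - 1"
    and p: "p \<in> W" "X p \<in> U" "X p \<in> U1"
  shows "pullback_quad_diff (kmetric \<kappa> s t) a b (local_rep (W, \<zeta>) (U, \<Phi>, V, \<phi>) X) (\<zeta> p) v w =
    pullback_quad_diff (kmetric \<kappa> s t) a b (local_rep (W, \<zeta>) (U1, \<Phi>1, V1, \<phi>1) X) (\<zeta> p) v w"
proof -
  define f f1 where "f = local_rep (W, \<zeta>) (U, \<Phi>, V, \<phi>) X"
    and "f1 = local_rep (W, \<zeta>) (U1, \<Phi>1, V1, \<phi>1) X"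
  define r r1 where "r z = kmetric \<kappa> s t (f z) (D f z 1) (D f z 1)"
    and "r1 z = kmetric \<kappa> s t (f1 z) (D f1 z 1) (D f1 z 1)" for z
  define T where "T = \<zeta> ` (W \<inter> X -` U \<inter> X -` U1)"
  have m: "model_surface \<kappa> s t (\<zeta> ` (W \<inter> X -` U)) f r"
    unfolding r_def[abs_def] by (rule local_rep_model_surface[OF assms(1-3) W C s f_def])
  have m1: "model_surface \<kappa> s t (\<zeta> ` (W \<inter> X -` U1)) f1 r1"
    unfolding r1_def[abs_def] by (rule local_rep_model_surface[OF assms(1-3) W C1 s f1_def])
  have "open (X -` U \<inter> X -` U1)"
    using X model_chartD(1)[OF assms(2) C] model_chartD(1)[OF assms(2) C1]
    unfolding conformal_immersion_def by (simp add: continuous_on_open_vimage open_Int)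
  then have T: "open T"
    using riemann_surface_open_image[OF assms(1) W] by (simp add: T_def Int_assoc)
  have z: "\<zeta> p \<in> T" using p by (auto simp: T_def)
  have mT: "model_surface \<kappa> s t T f r"
    by (rule model_surface.restrict[OF m T]) (auto simp: T_def)
  have m1T: "model_surface \<kappa> s t T f1 r1"
    by (rule model_surface.restrict[OF m1 T]) (auto simp: T_def)
  interpret B: model_surface \<kappa> s t T f r by (rule mT)
  interpret B1: model_surface \<kappa> s t T f1 r1 by (rule m1T)
  have tr: "kmetric \<kappa> s t (f y) (D f y v) (D f y w) = kmetric \<kappa> s t (f1 y) (D f1 y v) (D f1 y w)"
      "kmetric \<kappa> s t (f y) (D f y v) e3 = kmetric \<kappa> s t (f1 y) (D f1 y v) e3" if y: "y \<in> T" for y v w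
    using chart_transfer[OF assms(1,2) W C1 C T y _ f1_def f_def B1.f_differentiable[OF y]
        B.f_differentiable[OF y]] unfolding T_def by blast+
  \<comment> \<open>Compatibility of model charts speaks only of smoothness, the metric and
    \<open>e3\<close>; the orientation is obtained from the base charts at the common
    projection.\<close>
  have "base_orientation f (\<zeta> p) = base_orientation f1 (\<zeta> p)"
  proof (rule base_orientation_eq[OF T z B.f_differentiable[OF z] B1.f_differentiable[OF z]
        model_chartD(3)[OF assms(2) C] model_chartD(3)[OF assms(2) C1]])
    fix y assume "y \<in> T"
    then obtain q where q: "q \<in> W" "X q \<in> U" "X q \<in> U1" "y = \<zeta> q" by (auto simp: T_def)
    show "base_proj M (X (inv_into W \<zeta> y)) \<in> V \<and> base_proj M (X (inv_into W \<zeta> y)) \<in> V1 \<and>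
        base_coords (f y) = \<phi> (base_proj M (X (inv_into W \<zeta> y))) \<and>
        base_coords (f1 y) = \<phi>1 (base_proj M (X (inv_into W \<zeta> y)))"
      unfolding f_def f1_def q(4) local_rep_at[OF assms(1) W q(1)] inv_chart[OF assms(1) W q(1)]
      using model_chartD(5)[OF assms(2) C q(2)] model_chartD(5)[OF assms(2) C1 q(3)] by simp
  qed
  moreover have "r y = r1 y" if "y \<in> T" for y
    unfolding r_def r1_def by (rule tr(1)[OF that])
  ultimately show ?thesis
    unfolding f_def[symmetric] f1_def[symmetric]
    by (intro B1.pullback_quad_diff_cong[OF B.conformal_surface_axioms z] tr(2)) auto
qed

theorem theorem2p3:
  fixes \<kappa> \<tau> H :: real and a b a' b' :: complex
    and \<Sigma> :: "'s::t2_space complex_atlas"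
    and E :: "'e::{t2_space, second_countable_topology} killing_space"
    and L :: "'l::{t2_space, second_countable_topology} killing_space"
    and X :: "'s \<Rightarrow> 'e" and X' :: "'s \<Rightarrow> 'l"
  assumes "riemann_surface \<Sigma>" and "simply_connected (UNIV :: 's set)"
    and "E_space \<kappa> \<tau> E" and "L_space \<kappa> H L"
    and "conformal_immersion (E_metric \<kappa> \<tau>) \<Sigma> E X"
    and "nowhere_vertical \<Sigma> E X"
    and "mean_curvature_E \<kappa> \<tau> \<Sigma> E X H"
    and "conformal_immersion (L_metric \<kappa> H) \<Sigma> L X'"
    and "spacelike (L_metric \<kappa> H) \<Sigma> L X'"
    and "mean_curvature_L \<kappa> H \<Sigma> L X' \<tau>"
    and "dual_immersions \<kappa> \<tau> H E L X X'"
    and "complex_of_real (\<kappa> - 4 * \<tau>\<^sup>2) * a + 2 * (complex_of_real H + \<i> * complex_of_real \<tau>) * b = 0"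
    and "complex_of_real (\<kappa> + 4 * H\<^sup>2) * a' + 2 * \<i> * (complex_of_real H + \<i> * complex_of_real \<tau>) * b' = 0"
    and "a' = - \<i> * a"
    and "complex_of_real (\<kappa> - 4 * \<tau>\<^sup>2) * b' + complex_of_real (\<kappa> + 4 * H\<^sup>2) * b = 0"
    and degenerate: "\<kappa> = 0 \<and> \<tau> = 0 \<and> H = 0 \<longrightarrow> b' = - b"
  shows "\<forall>(W, \<zeta>)\<in>\<Sigma>. \<forall>(U, \<Phi>, V, \<phi>)\<in>model_charts E. \<forall>(U', \<Phi>', V', \<phi>')\<in>model_charts L.
           \<forall>p\<in>W. X p \<in> U \<and> X' p \<in> U' \<longrightarrow>
             (\<forall>v w. pullback_quad_diff (E_metric \<kappa> \<tau>) a b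
                       (local_rep (W, \<zeta>) (U, \<Phi>, V, \<phi>) X) (\<zeta> p) v w
                    = pullback_quad_diff (L_metric \<kappa> H) a' b'
                       (local_rep (W, \<zeta>) (U', \<Phi>', V', \<phi>') X') (\<zeta> p) v w)"
proof -
  have A: "riemann_surface \<Sigma>"
    and E: "killing_space_over (kmetric \<kappa> 1 \<tau>) \<kappa> E"
    and L: "killing_space_over (kmetric \<kappa> (- 1) (- H)) \<kappa> L"
    and X: "conformal_immersion (kmetric \<kappa> 1 \<tau>) \<Sigma> E X"
    and X': "conformal_immersion (kmetric \<kappa> (- 1) (- H)) \<Sigma> L X'"
    and vertical: "(1::real) = 1 \<and> nowhere_vertical \<Sigma> E X \<or> (1::real) = - 1"
    using assms by (simp_all add: E_space_def L_space_def E_metric_eq L_metric_eq)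
  have minus: "(- 1 :: real) = 1 \<and> nowhere_vertical \<Sigma> L X' \<or> (- 1 :: real) = - 1" by simp
  have b': "b + b' = 2 * (complex_of_real H - \<i> * complex_of_real \<tau>) * a"
    by (rule coefficient_relation[OF assms(12-16)])
  have "pullback_quad_diff (kmetric \<kappa> 1 \<tau>) a b (local_rep (W, \<zeta>) (U, \<Phi>, V, \<phi>) X) (\<zeta> p) v w =
      pullback_quad_diff (kmetric \<kappa> (- 1) (- H)) a' b' (local_rep (W, \<zeta>) (U', \<Phi>', V', \<phi>') X') (\<zeta> p) v w"
    if W: "(W, \<zeta>) \<in> \<Sigma>" and C: "(U, \<Phi>, V, \<phi>) \<in> model_charts E" and C': "(U', \<Phi>', V', \<phi>') \<in> model_charts L"
      and p: "p \<in> W" "X p \<in> U" "X' p \<in> U'"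
    for W \<zeta> U \<Phi> V \<phi> U' \<Phi>' V' \<phi>' p v w
  proof -
    have proj: "base_proj E (X q) = base_proj L (X' q)" for q
      using fun_cong[OF assms(11)[unfolded dual_immersions_def, THEN conjunct1], of q] by simp
    from assms(11)[unfolded dual_immersions_def, THEN conjunct2, THEN spec, of p]
    obtain N U0 \<Phi>0 U0' \<Phi>0' V0 \<phi>0 R u u' where dual: "open N \<and> p \<in> N \<and>
        (U0, \<Phi>0, V0, \<phi>0) \<in> model_charts E \<and> X ` N \<subseteq> U0 \<and>
        (U0', \<Phi>0', V0, \<phi>0) \<in> model_charts L \<and> X' ` N \<subseteq> U0' \<and>
        open R \<and> smooth_on R u \<and> smooth_on R u' \<and>
        \<Phi>0 ` X ` N = graph_over R u \<and> \<Phi>0' ` X' ` N = graph_over R u' \<and>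
        twin_relations \<kappa> \<tau> H R u u'"
      by (elim exE) (rule that)
    then have N: "open N" "p \<in> N"
      and C0: "(U0, \<Phi>0, V0, \<phi>0) \<in> model_charts E" and N0: "X ` N \<subseteq> U0"
      and C0': "(U0', \<Phi>0', V0, \<phi>0) \<in> model_charts L" and N0': "X' ` N \<subseteq> U0'"
      and R: "smooth_on R u" "smooth_on R u'"
      and graphs: "\<Phi>0 ` X ` N = graph_over R u" "\<Phi>0' ` X' ` N = graph_over R u'"
      and twin: "twin_relations \<kappa> \<tau> H R u u'"
      by - (elim conjE, assumption)+
    define f f' where "f = local_rep (W, \<zeta>) (U0, \<Phi>0, V0, \<phi>0) X"
      and "f' = local_rep (W, \<zeta>) (U0', \<Phi>0', V0, \<phi>0) X'"
    \<comment> \<open>Parameters of the neighbourhood on which duality makes both surfaces graphs.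
      The two charts lie over one base chart, so equal projections give equal base coordinates
      there.\<close>
    define T where "T = \<zeta> ` (W \<inter> N)"
    have T: "open T" unfolding T_def by (rule riemann_surface_open_image[OF A W N(1)])
    have z: "\<zeta> p \<in> T" using p(1) N(2) by (auto simp: T_def)
    note mE = local_rep_model_surface[OF A E X W C0 vertical f_def]
    note mL = local_rep_model_surface[OF A L X' W C0' minus f'_def]
    have mE': "model_surface \<kappa> 1 \<tau> T f (\<lambda>z. kmetric \<kappa> 1 \<tau> (f z) (D f z 1) (D f z 1))"
      by (rule model_surface.restrict[OF mE T]) (use N0 in \<open>auto simp: T_def\<close>)
    have mL': "model_surface \<kappa> (- 1) (- H) T f' (\<lambda>z. kmetric \<kappa> (- 1) (- H) (f' z) (D f' z 1) (D f' z 1))"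
      by (rule model_surface.restrict[OF mL T]) (use N0' in \<open>auto simp: T_def\<close>)
    have diff: "h differentiable (at q)" if "smooth_on R h" "q \<in> R" for h :: "real \<times> real \<Rightarrow> real" and q
    proof -
      have "Ck_on (Suc 0) R h" using that(1) by (simp add: smooth_on_def del: Ck_on.simps)
      then show ?thesis using that(2) by simp
    qed
    have T_at: "base_coords (f' y) = base_coords (f y) \<and> base_coords (f y) \<in> R \<and>
        f y $ 3 = u (base_coords (f y)) \<and> f' y $ 3 = u' (base_coords (f' y))" if "y \<in> T" for y
    proof -
      obtain q where q: "q \<in> W" "q \<in> N" "y = \<zeta> q" using \<open>y \<in> T\<close> by (auto simp: T_def)
      have f: "f y = \<Phi>0 (X q)" "f' y = \<Phi>0' (X' q)"
        unfolding f_def f'_def q(3) local_rep_at[OF A W q(1)] by simp_all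
      have "f y \<in> graph_over R u" "f' y \<in> graph_over R u'"
        using q(2) unfolding f graphs[symmetric] by auto
      moreover have "base_coords (f' y) = base_coords (f y)"
        using model_chartD(5)[OF E C0, of "X q"] model_chartD(5)[OF L C0', of "X' q"] N0 N0' q(2) proj[of q]
        by (simp add: f image_subset_iff)
      ultimately show ?thesis by (simp add: graph_over_def)
    qed
    \<comment> \<open>The identity in the charts provided by duality;
      \<open>pullback_quad_diff_chart\<close> then replaces the chart on each side by the given
      one.\<close>
    have "pullback_quad_diff (kmetric \<kappa> 1 \<tau>) a b f (\<zeta> p) v w =
        pullback_quad_diff (kmetric \<kappa> (- 1) (- H)) a' b' f' (\<zeta> p) v w"
      using T_at diff[OF R(1)] diff[OF R(2)] assms(14) b'
      by (intro twin_quadratic[OF mE' mL' z _ _ _ _ _ _ twin]) auto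
    moreover have "X p \<in> U0" "X' p \<in> U0'" using N(2) N0 N0' by auto
    ultimately show ?thesis
      using pullback_quad_diff_chart[OF A E X W C0 C vertical p(1,2)]
        pullback_quad_diff_chart[OF A L X' W C0' C' minus p(1,3)]
      by (simp add: f_def f'_def)
  qed
  then show ?thesis unfolding E_metric_eq L_metric_eq by blast
qed

end
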